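(* Let $\Gamma$ be a group, let $V$ be a vertex $\Gamma$-algebra with group homomorphisms $L:\Gamma\to GL(V)$ and $\phi:\Gamma\to\mathbb{C}^{\times}$, let $(W,Y_W)$ be a quasi $V$-module at infinity with associated group homomorphism $\Psi:\Gamma\to G$, and let $u,v\in V$. Then there exist finitely many $\sigma_1,\dots,\sigma_r\in\Gamma$ such that $\Psi(\sigma_1),\dots,\Psi(\sigma_r)$ are distinct in $G$ and $$[Y_W(u,x_1),Y_W(v,x_2)]=-\sum_{i=1}^{r}\sum_{j\ge 0}\phi(\sigma_i)^{-1}\,Y_W\big((L(\sigma_i)u)_jv,x_2\big)\frac{1}{j!}\left(\frac{\partial}{\partial x_2}\right)^{j}x_1^{-1}\delta\left(\frac{\Psi(\sigma_i)^{-1}(x_2)}{x_1}\right).$$ Furthermore, if $\Psi:\Gamma\to G$ is one-to-one, then $$[Y_W(u,x_1),Y_W(v,x_2)]=-\sum_{\sigma\in\Gamma}\sum_{j\ge 0}\phi(\sigma)^{-1}\,Y_W\big((L(\sigma)u)_jv,x_2\big)\frac{1}{j!}\left(\frac{\partial}{\partial x_2}\right)^{j}x_1^{-1}\delta\left(\frac{\Psi(\sigma)^{-1}(x_2)}{x_1}\right),$$ which is a finite sum (only finitely many pairs $(\sigma,j)$ give nonzero terms).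
   Context: All vector spaces are over $\mathbb{C}$. For a vertex algebra $V$ write $Y(u,x)v=\sum_{n\in\mathbb{Z}}(u_nv)x^{-n-1}$, with vacuum vector $\mathbf{1}$. $G=\{\alpha x+\beta\mid \alpha\in\mathbb{C}^{\times},\beta\in\mathbb{C}\}$ is a group under composition of functions; $g^{-1}$ denotes the inverse in $G$; $\Phi:G\to\mathbb{C}^{\times}$ is the homomorphism $\alpha x+\beta\mapsto\alpha$. For $g(x)=\alpha x+\beta\in G$ and $n\in\mathbb{Z}$, $g(x)^n$ is viewed in $\mathbb{C}((x^{-1}))$: $g(x)^n=\sum_{i\ge0}\binom{n}{i}\alpha^{n-i}\beta^ix^{n-i}$, and $\delta\left(\frac{g(x_2)}{x_1}\right)=\sum_{n\in\mathbb{Z}}x_1^{-n}g(x_2)^n$. For a vector space $W$, $\mathcal{E}^{o}(W)=\mathrm{Hom}(W,W((x^{-1})))\subset(\mathrm{End}\,W)[[x,x^{-1}]]$. For $a(x)=\sum_n a_nx^{-n-1}\in\mathcal{E}^o(W)$ and $g\in G$, $a(g(x))=\sum_n a_n g(x)^{-n-1}\in\mathcal{E}^o(W)$. $W((x_1^{-1},x_2^{-1}))$ is the space of series $\sum w_{m,n}x_1^mx_2^n$ with $m,n$ bounded above. Quasi module at infinity for a vertex algebra $V$: a vector space $W$ with a linear map $Y_W(\cdot,x):V\to\mathcal{E}^o(W)$ such that $Y_W(\mathbf 1,x)=1_W$ and for any $u,v\in V$ there is a nonzero polynomial $p(x_1,x_2)$ with $p(x_1,x_2)Y_W(u,x_1)Y_W(v,x_2)\in\mathrm{Hom}(W,W((x_1^{-1},x_2^{-1})))$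 and $\left(p(x_1,x_2)Y_W(u,x_1)Y_W(v,x_2)\right)|_{x_1=x_2+x_0}=p(x_0+x_2,x_2)Y_W(Y(u,x_0)v,x_2)$, where the substitution is expanded in nonnegative powers of $x_0$. Vertex $\Gamma$-algebra: a vertex algebra $V$ with group homomorphisms $L:\Gamma\to GL(V)$, $\phi:\Gamma\to\mathbb{C}^\times$ such that $L(g)\mathbf 1=\mathbf 1$ and $L(g)Y(u,x)v=Y(L(g)u,\phi(g)x)L(g)v$ for $g\in\Gamma$, $u,v\in V$. For a subgroup $H$ of $G$, a subset $U\subset\mathcal{E}^o(W)$ is $H$-local if for any $a(x),b(x)\in U$ there is a product $p(x_1,x_2)$ of linear polynomials $x_1-h(x_2)$ with $h\in H$ (repetitions allowed) such that $p(x_1,x_2)[a(x_1),b(x_2)]=0$. Quasi module at infinity for a vertex $\Gamma$-algebra $V$: a quasi module at infinity $(W,Y_W)$ for $V$ viewed as a vertex algebra, equipped with a group homomorphism $\Psi:\Gamma\to G$ such that $\phi=\Phi\circ\Psi$, $Y_W(L(g)v,x)=Y_W(v,\Psi(g)^{-1}(x))$ for $g\in\Gamma$, $v\in V$, and $\{Y_W(v,x)\mid v\in V\}$ is $\Psi(\Gamma)$-local. *)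

theory Defs
  imports
    Complex_Main
    "HOL-Library.Groups_Big_Fun"
    "HOL-Computational_Algebra.Polynomial"
    "HOL-Algebra.Group"
begin

section \<open>Groups\<close>

definition complex_units :: "complex monoid" where
  "complex_units = \<lparr>carrier = UNIV - {0}, mult = (*), one = 1\<rparr>"

definition general_linear_group :: "(complex \<Rightarrow> 'v::ab_group_add \<Rightarrow> 'v) \<Rightarrow> ('v \<Rightarrow> 'v) monoid" where
  "general_linear_group s =
     \<lparr>carrier = {f. Vector_Spaces.linear s s f \<and> bij f}, mult = (\<circ>), one = id\<rparr>"

text \<open>The group \<open>G\<close> of maps \<open>\<alpha> x + \<beta>\<close> with \<open>\<alpha> \<noteq> 0\<close> under composition. The element
  \<open>\<alpha> x + \<beta>\<close> is the polynomial \<open>[:\<beta>, \<alpha>:]\<close>.\<close>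

definition affine_group :: "complex poly monoid" where
  "affine_group = \<lparr>carrier = {g. degree g = 1}, mult = pcompose, one = [:0, 1:]\<rparr>"

text \<open>The homomorphism \<open>\<Phi>\<close> from \<open>G\<close> to the nonzero complex numbers.\<close>

definition affine_slope :: "complex poly \<Rightarrow> complex" where
  "affine_slope g = coeff g 1"

lemma group_affine_group: "group affine_group"
proof (rule groupI)
  fix g assume "g \<in> carrier affine_group"
  then have g: "degree g = 1" by (simp add: affine_group_def)
  then obtain a b where ab: "g = [:b, a:]" "a \<noteq> 0"
    by (metis degree1_coeffs)
  let ?h = "[:- b / a, 1 / a:]"
  have "?h \<in> carrier affine_group" "?h \<otimes>\<^bsub>affine_group\<^esub> g = \<one>\<^bsub>affine_group\<^esub>"
    using ab by (auto simp: affine_group_def pcompose_pCons)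
  then show "\<exists>h\<in>carrier affine_group. h \<otimes>\<^bsub>affine_group\<^esub> g = \<one>\<^bsub>affine_group\<^esub>"
    by blast
qed (auto simp: affine_group_def pcompose_assoc pcompose_pCons degree_pcompose)


section \<open>Formal series\<close>

text \<open>A field \<open>a(x) = \<Sum>n. a\<^sub>n x\<^bsup>-n-1\<^esup>\<close> is given by its modes \<open>a n = a\<^sub>n\<close>. A series in two
  variables \<open>x\<^sub>1, x\<^sub>2\<close> is given by exponents instead: \<open>F m n\<close> is the coefficient of
  \<open>x\<^sub>1\<^sup>m x\<^sub>2\<^sup>n\<close>, so \<open>a (- m - 1)\<close> is the coefficient of \<open>x\<^sup>m\<close> in \<open>a(x)\<close>.
  \<open>Sum_any\<close> adds up a finitely supported family; wherever it is used below, finiteness of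
  the support follows from the truncation conditions.\<close>

type_synonym 'w field_modes = "int \<Rightarrow> 'w \<Rightarrow> 'w"
type_synonym 'w op_series2 = "int \<Rightarrow> int \<Rightarrow> 'w \<Rightarrow> 'w"
type_synonym scalar_series2 = "int \<Rightarrow> int \<Rightarrow> complex"

text \<open>\<open>\<E>\<^sup>o(W) = Hom(W, W((x\<^bsup>-1\<^esup>)))\<close>: exponents \<open>-n-1\<close> bounded above means \<open>n\<close> bounded
  below.\<close>

definition fields_at_infinity ::
    "(complex \<Rightarrow> 'w::ab_group_add \<Rightarrow> 'w) \<Rightarrow> 'w field_modes set" where
  "fields_at_infinity s =
     {a. (\<forall>n. Vector_Spaces.linear s s (a n)) \<and> (\<forall>w. \<exists>N. \<forall>n<N. a n w = 0)}"

text \<open>\<open>Hom(W, W((x\<^sub>1\<^bsup>-1\<^esup>, x\<^sub>2\<^bsup>-1\<^esup>)))\<close>.\<close>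

definition hom_at_infinity2 ::
    "(complex \<Rightarrow> 'w::ab_group_add \<Rightarrow> 'w) \<Rightarrow> 'w op_series2 set" where
  "hom_at_infinity2 s =
     {F. (\<forall>m n. Vector_Spaces.linear s s (F m n)) \<and>
         (\<forall>w. \<exists>N. \<forall>m n. N < m \<or> N < n \<longrightarrow> F m n w = 0)}"

text \<open>The coefficient of \<open>x\<^sup>k\<close> in the expansion of \<open>g(x)\<^sup>n\<close> in \<open>\<complex>((x\<^bsup>-1\<^esup>))\<close>.\<close>

definition affine_power :: "complex poly \<Rightarrow> int \<Rightarrow> int \<Rightarrow> complex" where
  "affine_power g n k =
     (if k \<le> n
      then (of_int n gchoose nat (n - k)) * (coeff g 1 powi k) * coeff g 0 ^ nat (n - k)
      else 0)"

text \<open>\<open>a(g(x)) = \<Sum>n. a\<^sub>n g(x)\<^bsup>-n-1\<^esup>\<close>.\<close>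

definition affine_subst ::
    "(complex \<Rightarrow> 'w::ab_group_add \<Rightarrow> 'w) \<Rightarrow> 'w field_modes \<Rightarrow> complex poly \<Rightarrow> 'w field_modes" where
  "affine_subst s a g =
     (\<lambda>k w. Sum_any (\<lambda>n. s (affine_power g (- n - 1) (- k - 1)) (a n w)))"

text \<open>\<open>x\<^sub>1\<^bsup>-1\<^esup> \<delta>(g(x\<^sub>2)/x\<^sub>1) = \<Sum>n. x\<^sub>1\<^bsup>-n-1\<^esup> g(x\<^sub>2)\<^sup>n\<close>.\<close>

definition affine_delta :: "complex poly \<Rightarrow> scalar_series2" where
  "affine_delta g = (\<lambda>m k. affine_power g (- m - 1) k)"

definition deriv_x2 :: "scalar_series2 \<Rightarrow> scalar_series2" where
  "deriv_x2 f = (\<lambda>m k. of_int (k + 1) * f m (k + 1))"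

text \<open>The product \<open>a(x\<^sub>2) f(x\<^sub>1, x\<^sub>2)\<close>.\<close>

definition field_x2_times ::
    "(complex \<Rightarrow> 'w::ab_group_add \<Rightarrow> 'w) \<Rightarrow> 'w field_modes \<Rightarrow> scalar_series2 \<Rightarrow> 'w op_series2" where
  "field_x2_times s a f = (\<lambda>m k w. Sum_any (\<lambda>l. s (f m l) (a (- (k - l) - 1) w)))"

text \<open>\<open>a(x\<^sub>1) b(x\<^sub>2)\<close> and \<open>[a(x\<^sub>1), b(x\<^sub>2)]\<close>.\<close>

definition op_product ::
    "'w field_modes \<Rightarrow> 'w field_modes \<Rightarrow> 'w op_series2" where
  "op_product a b = (\<lambda>m n w. a (- m - 1) (b (- n - 1) w))"

definition op_commutator ::
    "'w::ab_group_add field_modes \<Rightarrow> 'w field_modes \<Rightarrow> 'w op_series2" where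
  "op_commutator a b =
     (\<lambda>m n w. a (- m - 1) (b (- n - 1) w) - b (- n - 1) (a (- m - 1) w))"

text \<open>A polynomial \<open>p(x\<^sub>1, x\<^sub>2)\<close> is an element of \<open>\<complex>[x\<^sub>2][x\<^sub>1]\<close>: the outer variable is
  \<open>x\<^sub>1\<close>, and \<open>coeff (coeff p i) j\<close> belongs to \<open>x\<^sub>1\<^sup>i x\<^sub>2\<^sup>j\<close>.\<close>

definition poly2_times ::
    "(complex \<Rightarrow> 'w::ab_group_add \<Rightarrow> 'w) \<Rightarrow> complex poly poly \<Rightarrow> 'w op_series2 \<Rightarrow> 'w op_series2" where
  "poly2_times s p F =
     (\<lambda>m n w. \<Sum>i\<le>degree p. \<Sum>j\<le>degree (coeff p i).
        s (coeff (coeff p i) j) (F (m - int i) (n - int j) w))"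

text \<open>\<open>F(x\<^sub>1, x\<^sub>2)|\<close> at \<open>x\<^sub>1 = x\<^sub>2 + x\<^sub>0\<close>, where
  \<open>x\<^sub>1\<^sup>m\<close> becomes \<open>\<Sum>i\<ge>0. (m choose i) x\<^sub>2\<^bsup>m-i\<^esup> x\<^sub>0\<^sup>i\<close>; the result is a series in
  \<open>x\<^sub>0, x\<^sub>2\<close>, in this order.\<close>

definition shift_subst ::
    "(complex \<Rightarrow> 'w::ab_group_add \<Rightarrow> 'w) \<Rightarrow> 'w op_series2 \<Rightarrow> 'w op_series2" where
  "shift_subst s F =
     (\<lambda>i k w. if i < 0 then 0
              else Sum_any (\<lambda>m. s (of_int m gchoose nat i) (F m (k - (m - i)) w)))"

text \<open>\<open>p(x\<^sub>0 + x\<^sub>2, x\<^sub>2)\<close>, with outer variable \<open>x\<^sub>0\<close>.\<close>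

definition poly2_shift :: "complex poly poly \<Rightarrow> complex poly poly" where
  "poly2_shift p = pcompose p [:[:0, 1:], 1:]"

text \<open>\<open>[:- h, 1:]\<close> is the polynomial \<open>x\<^sub>1 - h(x\<^sub>2)\<close>.\<close>

definition H_local ::
    "(complex \<Rightarrow> 'w::ab_group_add \<Rightarrow> 'w) \<Rightarrow> complex poly set \<Rightarrow> 'w field_modes set \<Rightarrow> bool" where
  "H_local s H U \<longleftrightarrow>
     (\<forall>a\<in>U. \<forall>b\<in>U. \<exists>hs. set hs \<subseteq> H \<and>
        poly2_times s (\<Prod>h\<leftarrow>hs. [:- h, 1:]) (op_commutator a b) = (\<lambda>_ _ _. 0))"


section \<open>Vertex algebras\<close>

text \<open>\<open>Y u n v\<close> is \<open>u\<^sub>n v\<close>. The axiom \<open>Jacobi\<close> is the coefficient of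
  \<open>x\<^sub>0\<^bsup>-l-1\<^esup> x\<^sub>1\<^bsup>-m-1\<^esup> x\<^sub>2\<^bsup>-n-1\<^esup>\<close> in the Jacobi identity
  \<open>x\<^sub>0\<^bsup>-1\<^esup> \<delta>((x\<^sub>1-x\<^sub>2)/x\<^sub>0) Y(u,x\<^sub>1) Y(v,x\<^sub>2) w
    - x\<^sub>0\<^bsup>-1\<^esup> \<delta>((x\<^sub>2-x\<^sub>1)/(-x\<^sub>0)) Y(v,x\<^sub>2) Y(u,x\<^sub>1) w
    = x\<^sub>2\<^bsup>-1\<^esup> \<delta>((x\<^sub>1-x\<^sub>0)/x\<^sub>2) Y(Y(u,x\<^sub>0)v,x\<^sub>2) w\<close>.\<close>

locale vertex_algebra = vector_space sV
  for sV :: "complex \<Rightarrow> 'v::ab_group_add \<Rightarrow> 'v" +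
  fixes Y :: "'v \<Rightarrow> int \<Rightarrow> 'v \<Rightarrow> 'v" and vac :: 'v
  assumes Y_linear_left: "Vector_Spaces.linear sV sV (\<lambda>u. Y u n v)"
    and Y_linear_right: "Vector_Spaces.linear sV sV (Y u n)"
    and Y_truncation: "\<exists>N. \<forall>n\<ge>N. Y u n v = 0"
    and Y_vacuum: "Y vac n v = (if n = - 1 then v else 0)"
    and Y_creation: "n \<ge> 0 \<Longrightarrow> Y v n vac = 0" "Y v (- 1) vac = v"
    and Jacobi:
      "Sum_any (\<lambda>i::nat. sV ((- 1) ^ i * (of_int l gchoose i))
          (Y u (m + l - int i) (Y v (n + int i) w)))
       - Sum_any (\<lambda>i::nat. sV ((- 1) powi l * (- 1) ^ i * (of_int l gchoose i))
          (Y v (n + l - int i) (Y u (m + int i) w)))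
       = Sum_any (\<lambda>i::nat. sV (of_int m gchoose i)
          (Y (Y u (l + int i) v) (m + n - int i) w))"

locale vertex_group_algebra = vertex_algebra sV Y vac + group \<Gamma>
  for sV :: "complex \<Rightarrow> 'v::ab_group_add \<Rightarrow> 'v"
    and Y :: "'v \<Rightarrow> int \<Rightarrow> 'v \<Rightarrow> 'v" and vac :: 'v
    and \<Gamma> :: "('g, 'b) monoid_scheme" (structure) +
  fixes L :: "'g \<Rightarrow> 'v \<Rightarrow> 'v" and \<phi> :: "'g \<Rightarrow> complex"
  assumes L_hom: "L \<in> hom \<Gamma> (general_linear_group sV)"
    and phi_hom: "\<phi> \<in> hom \<Gamma> complex_units"
    and L_vacuum: "g \<in> carrier \<Gamma> \<Longrightarrow> L g vac = vac"
    and L_Y: "g \<in> carrier \<Gamma> \<Longrightarrow> L g (Y u n v) = sV (\<phi> g powi (- n - 1)) (Y (L g u) n (L g v))"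

locale quasi_module_at_infinity = V: vertex_algebra sV Y vac + W: vector_space sW
  for sV :: "complex \<Rightarrow> 'v::ab_group_add \<Rightarrow> 'v"
    and Y :: "'v \<Rightarrow> int \<Rightarrow> 'v \<Rightarrow> 'v" and vac :: 'v
    and sW :: "complex \<Rightarrow> 'w::ab_group_add \<Rightarrow> 'w" +
  fixes YW :: "'v \<Rightarrow> 'w field_modes"
  assumes YW_field: "YW v \<in> fields_at_infinity sW"
    and YW_linear: "Vector_Spaces.linear sV sW (\<lambda>v. YW v n w)"
    and YW_vacuum: "YW vac n w = (if n = - 1 then w else 0)"
    and YW_quasi_associativity:
      "\<exists>p. p \<noteq> 0 \<and>
         poly2_times sW p (op_product (YW u) (YW v)) \<in> hom_at_infinity2 sW \<and>
         shift_subst sW (poly2_times sW p (op_product (YW u) (YW v))) =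
           poly2_times sW (poly2_shift p) (\<lambda>k n. YW (Y u (- k - 1) v) (- n - 1))"

locale vertex_group_quasi_module_at_infinity =
    vertex_group_algebra sV Y vac \<Gamma> L \<phi> + quasi_module_at_infinity sV Y vac sW YW
  for sV :: "complex \<Rightarrow> 'v::ab_group_add \<Rightarrow> 'v"
    and Y :: "'v \<Rightarrow> int \<Rightarrow> 'v \<Rightarrow> 'v" and vac :: 'v
    and \<Gamma> :: "('g, 'b) monoid_scheme" (structure)
    and L :: "'g \<Rightarrow> 'v \<Rightarrow> 'v" and \<phi> :: "'g \<Rightarrow> complex"
    and sW :: "complex \<Rightarrow> 'w::ab_group_add \<Rightarrow> 'w"
    and YW :: "'v \<Rightarrow> 'w field_modes" +
  fixes \<Psi> :: "'g \<Rightarrow> complex poly"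
  assumes Psi_hom: "\<Psi> \<in> hom \<Gamma> affine_group"
    and phi_eq: "g \<in> carrier \<Gamma> \<Longrightarrow> \<phi> g = affine_slope (\<Psi> g)"
    and YW_L: "g \<in> carrier \<Gamma> \<Longrightarrow> YW (L g v) = affine_subst sW (YW v) (inv\<^bsub>affine_group\<^esub> (\<Psi> g))"
    and YW_local: "H_local sW (\<Psi> ` carrier \<Gamma>) (range YW)"

text \<open>The series \<open>\<phi>(\<sigma>)\<^bsup>-1\<^esup> Y\<^sub>W((L(\<sigma>)u)\<^sub>j v, x\<^sub>2) (1/j!) (\<partial>/\<partial>x\<^sub>2)\<^sup>j
  x\<^sub>1\<^bsup>-1\<^esup> \<delta>(\<Psi>(\<sigma>)\<^bsup>-1\<^esup>(x\<^sub>2)/x\<^sub>1)\<close>.\<close>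

definition commutator_term ::
    "('v \<Rightarrow> int \<Rightarrow> 'v \<Rightarrow> 'v) \<Rightarrow> ('g \<Rightarrow> 'v \<Rightarrow> 'v) \<Rightarrow> ('g \<Rightarrow> complex) \<Rightarrow>
     (complex \<Rightarrow> 'w::ab_group_add \<Rightarrow> 'w) \<Rightarrow> ('v \<Rightarrow> 'w field_modes) \<Rightarrow> ('g \<Rightarrow> complex poly) \<Rightarrow>
     'v \<Rightarrow> 'v \<Rightarrow> 'g \<Rightarrow> nat \<Rightarrow> 'w op_series2" where
  "commutator_term Y L \<phi> sW YW \<Psi> u v \<sigma> j =
     (\<lambda>m n w. sW (inverse (\<phi> \<sigma>))
        (field_x2_times sW (YW (Y (L \<sigma> u) (int j) v))
           (\<lambda>m n. (deriv_x2 ^^ j) (affine_delta (inv\<^bsub>affine_group\<^esub> (\<Psi> \<sigma>))) m n / fact j)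
           m n w))"

end

theory Submission
  imports
    Defs
    "HOL-Library.Function_Algebras"
    "HOL-Computational_Algebra.Formal_Power_Series"
begin

text \<open>
  Write \<open>a = Y\<^sub>W(u, x\<^sub>1)\<close>, \<open>b = Y\<^sub>W(v, x\<^sub>2)\<close>, fix a vector \<open>w\<close>, and let \<open>D = [a, b] w\<close>.
  Locality gives a product \<open>q\<close> of factors \<open>x\<^sub>1 - h(x\<^sub>2)\<close> with \<open>q D = 0\<close>. A series killed by
  \<open>q\<close> is a sum of derivatives of delta functions supported on the curves \<open>x\<^sub>1 = h(x\<^sub>2)\<close>, so
  the commutator formula amounts to identifying the contribution of each curve. This is done one
  curve at a time.

  First take the diagonal \<open>x\<^sub>1 = x\<^sub>2\<close> and write \<open>q = (x\<^sub>1 - x\<^sub>2)\<^sup>k q'\<close> with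
  \<open>q'\<close> prime to \<open>x\<^sub>1 - x\<^sub>2\<close>. The common value \<open>F = q a b w = q b a w\<close> has exponents bounded
  above in both variables, so \<open>a b w\<close> and \<open>b a w\<close> are the expansions of one rational
  expression \<open>F / q\<close>, in the region where \<open>x\<^sub>2\<close> is large and the one where \<open>x\<^sub>1\<close> is large.
  Quasi-associativity holds with some polynomial \<open>p\<close>; since a nonzero polynomial can be cancelled
  in Laurent series in \<open>x\<^sub>0\<close>, it holds with \<open>q\<close> in place of \<open>p\<close>. Hence
  \<open>Y\<^sub>W(Y(u, x\<^sub>0) v, x\<^sub>2) w\<close> is the expansion of the same \<open>F / q\<close> at \<open>x\<^sub>1 = x\<^sub>2 + x\<^sub>0\<close>.
  The difference of the two expansions of \<open>q' F / q = F / (x\<^sub>1 - x\<^sub>2)\<^sup>k\<close> is minus its residue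
  along the diagonal (\<open>difference_of_expansions\<close>, where both sides are computed and agree by
  Vandermonde's identity). This yields \<open>commutator_of_associativity\<close>: \<open>q'\<close> kills the sum of
  \<open>D\<close> and the delta series built from the singular part of \<open>Y\<^sub>W(Y(u, x\<^sub>0) v, x\<^sub>2) w\<close>, and this
  singular part has a pole of order at most \<open>k\<close>.

  For a general \<open>\<sigma>\<close> the same is applied to \<open>L(\<sigma>) u\<close>. The substitution
  \<open>x\<^sub>1 \<mapsto> \<Psi>(\<sigma>)(x\<^sub>1)\<close> carries \<open>Y\<^sub>W(L(\<sigma>) u, x\<^sub>1)\<close> back to \<open>a\<close>, the diagonal to the curve
  \<open>x\<^sub>1 = \<Psi>(\<sigma>)\<^bsup>-1\<^esup>(x\<^sub>2)\<close>, and the delta series to the terms of the statement, with the Jacobian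
  \<open>\<phi>(\<sigma>)\<^bsup>-1\<^esup>\<close> (\<open>commutator_at\<close>).

  Finally let \<open>X\<close> be \<open>D\<close> plus all these contributions, one \<open>\<sigma>\<close> for each curve. For every curve,
  \<open>X\<close> is killed by the product of the factors of \<open>q\<close> belonging to the other curves. Such products
  have no common root, and multiplication by nonzero polynomials in \<open>x\<^sub>2\<close> is injective on the
  series that occur, so \<open>X = 0\<close> (\<open>vanishes_if_locally\<close>).
\<close>

section \<open>Series in two variables as a module over polynomials\<close>

text \<open>For a fixed vector \<open>w\<close> all operator series become elements of this type;
  as in the operator series, the coefficient of \<open>x\<^sub>1\<^sup>m x\<^sub>2\<^sup>n\<close> sits at \<open>m n\<close>.\<close>
type_synonym 'w series2 = "int \<Rightarrow> int \<Rightarrow> 'w"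

locale complex_vector_space = vector_space scale
  for scale :: "complex \<Rightarrow> 'w::ab_group_add \<Rightarrow> 'w" (infixr "*s" 75)
begin

text \<open>The action of \<open>\<complex>[x\<^sub>2][x\<^sub>1]\<close>; pointwise in \<open>w\<close> it is \<open>poly2_times\<close>.\<close>
definition act :: "complex poly poly \<Rightarrow> 'w series2 \<Rightarrow> 'w series2" where
  "act p X = (\<lambda>m n. \<Sum>i\<le>degree p. \<Sum>j\<le>degree (coeff p i).
     coeff (coeff p i) j *s X (m - int i) (n - int j))"

definition scale_series :: "complex \<Rightarrow> 'w series2 \<Rightarrow> 'w series2" where
  "scale_series c X = (\<lambda>m n. c *s X m n)"

definition shift1 :: "'w series2 \<Rightarrow> 'w series2" where
  "shift1 X = (\<lambda>m n. X (m - 1) n)"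

definition shift2 :: "'w series2 \<Rightarrow> 'w series2" where
  "shift2 X = (\<lambda>m n. X m (n - 1))"

lemma act_bounds:
  assumes "degree p \<le> I" "\<And>i. degree (coeff p i) \<le> J"
  shows "act p X m n = (\<Sum>i\<le>I. \<Sum>j\<le>J. coeff (coeff p i) j *s X (m - int i) (n - int j))"
proof -
  have "act p X m n = (\<Sum>i\<le>degree p. \<Sum>j\<le>J. coeff (coeff p i) j *s X (m - int i) (n - int j))"
    unfolding act_def using assms(2)
    by (intro sum.cong refl sum.mono_neutral_left) (auto simp: coeff_eq_0)
  also have "\<dots> = (\<Sum>i\<le>I. \<Sum>j\<le>J. coeff (coeff p i) j *s X (m - int i) (n - int j))"
    using assms(1) by (intro sum.mono_neutral_left) (auto simp: coeff_eq_0)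
  finally show ?thesis .
qed

lemma coeff_degree_bounded: "\<exists>J. \<forall>i. degree (coeff (p :: complex poly poly) i) \<le> J"
proof -
  have "degree (coeff p i) \<le> Max ((\<lambda>i. degree (coeff p i)) ` {..degree p})" for i
  proof (cases "i \<le> degree p")
    case True
    then show ?thesis by (intro Max_ge) auto
  qed (simp add: coeff_eq_0)
  then show ?thesis by blast
qed

lemma act_add_left: "act (p + q) X = act p X + act q X"
proof (intro ext)
  fix m n
  obtain J J' where J: "\<And>i. degree (coeff p i) \<le> J" "\<And>i. degree (coeff q i) \<le> J'"
    using coeff_degree_bounded by metis
  let ?I = "max (degree p) (degree q)" and ?J = "max J J'"
  have p: "act p X m n = (\<Sum>i\<le>?I. \<Sum>j\<le>?J. coeff (coeff p i) j *s X (m - int i) (n - int j))"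
    using J by (intro act_bounds) (auto simp: le_max_iff_disj)
  have q: "act q X m n = (\<Sum>i\<le>?I. \<Sum>j\<le>?J. coeff (coeff q i) j *s X (m - int i) (n - int j))"
    using J by (intro act_bounds) (auto simp: le_max_iff_disj)
  have "degree (coeff (p + q) i) \<le> ?J" for i
    unfolding coeff_add by (rule order.trans[OF degree_add_le_max]) (use J[of i] in linarith)
  then have "act (p + q) X m n =
      (\<Sum>i\<le>?I. \<Sum>j\<le>?J. coeff (coeff (p + q) i) j *s X (m - int i) (n - int j))"
    by (intro act_bounds degree_add_le_max) auto
  then show "act (p + q) X m n = (act p X + act q X) m n"
    by (simp add: p q scale_left_distrib sum.distrib)
qed

lemma act_add_right: "act p (X + X') = act p X + act p X'"
  by (intro ext) (simp add: act_def scale_right_distrib sum.distrib)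

lemma act_0 [simp]: "act 0 X = 0"
  by (intro ext) (simp add: act_def)

lemma act_pCons: "act (pCons c p) X = act [:c:] X + shift1 (act p X)"
proof (intro ext)
  fix m n
  obtain J where J: "\<And>i. degree (coeff (pCons c p) i) \<le> J"
    using coeff_degree_bounded by metis
  have Jp: "degree (coeff p i) \<le> J" for i
    using J[of "Suc i"] by simp
  have Jc: "degree (coeff [:c:] i) \<le> J" for i
    using J[of 0] by (cases i) auto
  have "act (pCons c p) X m n =
      (\<Sum>i\<le>Suc (degree p). \<Sum>j\<le>J. coeff (coeff (pCons c p) i) j *s X (m - int i) (n - int j))"
    using J by (intro act_bounds degree_pCons_le) auto
  also have "\<dots> = (\<Sum>j\<le>J. coeff c j *s X m (n - int j)) +
      (\<Sum>i\<le>degree p. \<Sum>j\<le>J. coeff (coeff p i) j *s X (m - 1 - int i) (n - int j))"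
    by (subst sum.atMost_Suc_shift) (simp add: algebra_simps)
  also have "(\<Sum>j\<le>J. coeff c j *s X m (n - int j)) = act [:c:] X m n"
    by (subst act_bounds[of _ 0 J]) (use Jc in auto)
  also have "(\<Sum>i\<le>degree p. \<Sum>j\<le>J. coeff (coeff p i) j *s X (m - 1 - int i) (n - int j))
      = act p X (m - 1) n"
    using Jp by (intro act_bounds[symmetric]) auto
  finally show "act (pCons c p) X m n = (act [:c:] X + shift1 (act p X)) m n"
    by (simp add: shift1_def)
qed

lemma act_const_pCons: "act [:pCons a c:] X = scale_series a X + shift2 (act [:c:] X)"
proof (intro ext)
  fix m n
  have "act [:pCons a c:] X m n =
      (\<Sum>i\<le>0. \<Sum>j\<le>Suc (degree c). coeff (coeff [:pCons a c:] i) j *s X (m - int i) (n - int j))"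
    by (intro act_bounds) (auto simp: coeff_pCons degree_pCons_le split: nat.split)
  also have "\<dots> = a *s X m n + (\<Sum>j\<le>degree c. coeff c j *s X m (n - 1 - int j))"
    by (simp add: sum.atMost_Suc_shift algebra_simps del: sum.atMost_Suc)
  finally show "act [:pCons a c:] X m n = (scale_series a X + shift2 (act [:c:] X)) m n"
    by (simp add: shift2_def act_def scale_series_def)
qed

lemma shift1_eq_act: "shift1 X = act [:0, 1:] X"
  by (simp add: act_def shift1_def fun_eq_iff)

lemma shift2_eq_act: "shift2 X = act [:[:0, 1:]:] X"
  by (simp add: act_def shift2_def fun_eq_iff)

lemma scale_series_eq_act: "scale_series a X = act [:[:a:]:] X"
  by (simp add: act_def scale_series_def fun_eq_iff)

text \<open>Associativity is what makes polynomial factors commute past each other; all later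
  manipulations of annihilators rest on it.\<close>
lemma act_mult: "act (p * q) X = act p (act q X)"
proof -
  have smult: "act (smult c q) X = act [:c:] (act q X)" for c
  proof (induction c)
    case (pCons a c)
    \<comment> \<open>A polynomial in \<open>x\<^sub>2\<close> is built from scalars and multiplication by \<open>x\<^sub>2\<close>.\<close>
    have split: "act (smult (pCons a c) q) X =
        act (smult [:a:] q) X + act (smult [:0, 1:] (smult c q)) X"
      by (subst act_add_left[symmetric], rule arg_cong[where f = "\<lambda>p. act p X"])
        (simp add: smult_add_left[symmetric])
    have 1: "act (smult [:a:] q) X = scale_series a (act q X)"
    proof (intro ext)
      show "act (smult [:a:] q) X m n = scale_series a (act q X) m n" for m n
        by (cases "a = 0") (auto simp: act_def scale_series_def scale_sum_right)
    qed
    have 2: "act (smult [:0, 1:] r) X = shift2 (act r X)" for r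
    proof (intro ext)
      fix m n
      obtain J where J: "\<And>i. degree (coeff r i) \<le> J"
        using coeff_degree_bounded by metis
      have "degree (coeff (smult [:0, 1:] r) i) \<le> Suc J" for i
        using J[of i] by (simp add: degree_pCons_le le_trans[OF degree_pCons_le])
      then have "act (smult [:0, 1:] r) X m n = (\<Sum>i\<le>degree r. \<Sum>j\<le>Suc J.
          coeff (coeff (smult [:0, 1:] r) i) j *s X (m - int i) (n - int j))"
        by (intro act_bounds) (auto simp: degree_smult_le)
      also have "\<dots> = (\<Sum>i\<le>degree r. \<Sum>j\<le>J. coeff (coeff r i) j *s X (m - int i) (n - 1 - int j))"
        by (simp add: sum.atMost_Suc_shift algebra_simps del: sum.atMost_Suc)
      also have "\<dots> = act r X m (n - 1)"
        using J by (intro act_bounds[symmetric]) auto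
      finally show "act (smult [:0, 1:] r) X m n = shift2 (act r X) m n"
        by (simp add: shift2_def)
    qed
    show ?case
      by (simp only: split 1 2 act_const_pCons pCons.IH)
  qed simp
  show ?thesis
  proof (induction p)
    case (pCons c p)
    show ?case
      by (simp add: act_pCons[of c p] mult_pCons_left act_add_left act_pCons[of 0] smult pCons.IH)
  qed simp
qed

lemma act_1: "act 1 X = X"
  by (simp add: act_def fun_eq_iff)

sublocale series: module act
  by unfold_locales (simp_all add: act_add_left act_add_right act_mult act_1)

text \<open>A set closed under these operations is a submodule. Infinite sums are only meaningful under
  boundedness conditions on the exponents, and each such condition defines a submodule.\<close>
definition series_space :: "'w series2 set \<Rightarrow> bool" where
  "series_space K \<longleftrightarrow> 0 \<in> K \<and> (\<forall>X\<in>K. \<forall>X'\<in>K. X + X' \<in> K) \<and>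
     (\<forall>X\<in>K. \<forall>c. scale_series c X \<in> K) \<and> (\<forall>X\<in>K. shift1 X \<in> K) \<and> (\<forall>X\<in>K. shift2 X \<in> K)"

lemma series_spaceD:
  assumes "series_space K"
  shows "0 \<in> K" "X \<in> K \<Longrightarrow> X' \<in> K \<Longrightarrow> X + X' \<in> K" "X \<in> K \<Longrightarrow> scale_series c X \<in> K"
    "X \<in> K \<Longrightarrow> shift1 X \<in> K" "X \<in> K \<Longrightarrow> shift2 X \<in> K"
  using assms unfolding series_space_def by blast+

lemma series_space_diff:
  assumes "series_space K" "X \<in> K" "X' \<in> K"
  shows "X - X' \<in> K"
proof -
  have "X - X' = X + scale_series (- 1) X'"
    by (intro ext) (simp add: scale_series_def)
  then show ?thesis using series_spaceD[OF assms(1)] assms(2,3) by (simp only:)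
qed

lemma series_space_act_const:
  assumes "series_space K" "X \<in> K" shows "act [:c:] X \<in> K"
proof (induction c)
  case 0 show ?case using series_spaceD(1)[OF assms(1)] by (simp only: pCons_0_0 act_0)
next
  case (pCons a c) then show ?case
    unfolding act_const_pCons by (intro series_spaceD[OF assms(1)] assms(2))
qed

lemma series_space_act:
  assumes "series_space K" "X \<in> K" shows "act p X \<in> K"
proof (induction p)
  case 0 show ?case using series_spaceD(1)[OF assms(1)] by (simp only: act_0)
next
  case (pCons c p) then show ?case
    unfolding act_pCons[of c p] by (intro series_spaceD[OF assms(1)] series_space_act_const[OF assms])
qed

text \<open>A linear map which commutes with \<open>x\<^sub>2\<close> and turns \<open>x\<^sub>1\<close> into multiplication by \<open>g\<close>
  is semilinear along \<open>x\<^sub>1 \<mapsto> g\<close>. It is used for the three substitutions below.\<close>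
lemma intertwine_act:
  assumes K: "series_space K"
    and add: "\<And>X X'. X \<in> K \<Longrightarrow> X' \<in> K \<Longrightarrow> f (X + X') = f X + f X'"
    and scl: "\<And>X c. X \<in> K \<Longrightarrow> f (scale_series c X) = scale_series c (f X)"
    and sh1: "\<And>X. X \<in> K \<Longrightarrow> f (shift1 X) = act g (f X)"
    and sh2: "\<And>X. X \<in> K \<Longrightarrow> f (shift2 X) = shift2 (f X)"
    and X: "X \<in> K"
  shows "f (act p X) = act (pcompose p g) (f X)"
proof -
  have K0: "0 \<in> K" using K by (simp add: series_space_def)
  have f0: "f 0 = 0" using add[OF K0 K0] by simp
  have const: "f (act [:c:] X) = act [:c:] (f X)" for c
  proof (induction c)
    case (pCons a c)
    have "f (scale_series a X + shift2 (act [:c:] X)) =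
        scale_series a (f X) + shift2 (f (act [:c:] X))"
      by (simp only: add scl sh2 series_spaceD[OF K] series_space_act[OF K X] X)
    then show ?case
      by (simp only: act_const_pCons pCons.IH)
  qed (simp add: f0 del: zero_fun_apply)
  show ?thesis
  proof (induction p)
    case (pCons c p)
    have "f (act [:c:] X + shift1 (act p X)) = act [:c:] (f X) + act g (f (act p X))"
      by (simp only: add sh1 const series_spaceD[OF K] series_space_act[OF K X] X)
    then show ?case
      by (simp only: act_pCons[of c p] pCons.IH pcompose_pCons act_add_left act_mult)
  qed (simp add: f0 del: zero_fun_apply)
qed

section \<open>Boundedness of exponents\<close>

text \<open>Without further qualification, bounded refers to exponents bounded above, with a bound that
  may depend on the exponent of the other variable.\<close>

definition x1_bounded :: "'w series2 set" where
  "x1_bounded = {X. \<forall>n. \<exists>N. \<forall>m>N. X m n = 0}"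

definition x2_bounded :: "'w series2 set" where
  "x2_bounded = {X. \<forall>m. \<exists>N. \<forall>n>N. X m n = 0}"

definition uniformly_x1_bounded :: "'w series2 set" where
  "uniformly_x1_bounded = {X. \<exists>N. \<forall>m>N. \<forall>n. X m n = 0}"

definition uniformly_x2_bounded :: "'w series2 set" where
  "uniformly_x2_bounded = {X. \<exists>N. \<forall>m. \<forall>n>N. X m n = 0}"

definition x1_bounded_below :: "'w series2 set" where
  "x1_bounded_below = {X. \<exists>M. \<forall>m<M. \<forall>n. X m n = 0}"

abbreviation jointly_bounded :: "'w series2 set" where
  "jointly_bounded \<equiv> uniformly_x1_bounded \<inter> uniformly_x2_bounded"

text \<open>Laurent series in \<open>x\<^sub>0\<close>, which then takes the place of \<open>x\<^sub>1\<close>, with coefficients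
  in \<open>W((x\<^sub>2\<^bsup>-1\<^esup>))\<close>.\<close>
abbreviation laurent_x0 :: "'w series2 set" where
  "laurent_x0 \<equiv> x1_bounded_below \<inter> x2_bounded"

lemma series_spaceI:
  assumes "0 \<in> K" "\<And>X X'. X \<in> K \<Longrightarrow> X' \<in> K \<Longrightarrow> X + X' \<in> K" "\<And>X c. X \<in> K \<Longrightarrow> scale_series c X \<in> K"
    "\<And>X. X \<in> K \<Longrightarrow> shift1 X \<in> K" "\<And>X. X \<in> K \<Longrightarrow> shift2 X \<in> K"
  shows "series_space K"
  unfolding series_space_def by (intro conjI ballI allI assms)

lemma series_space_Int: "series_space K \<Longrightarrow> series_space K' \<Longrightarrow> series_space (K \<inter> K')"
  by (intro series_spaceI) (simp_all add: series_spaceD)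

lemma series_space_x1_bounded: "series_space x1_bounded"
proof (rule series_spaceI)
  fix X X' assume X: "X \<in> x1_bounded" "X' \<in> x1_bounded"
  show "X + X' \<in> x1_bounded" unfolding x1_bounded_def
  proof (intro CollectI allI)
    fix n
    obtain N N' where "\<forall>m>N. X m n = 0" "\<forall>m>N'. X' m n = 0"
      using X unfolding x1_bounded_def by blast
    then show "\<exists>N. \<forall>m>N. (X + X') m n = 0" by (intro exI[of _ "max N N'"]) auto
  qed
next
  fix X assume X: "X \<in> x1_bounded"
  show "shift1 X \<in> x1_bounded" unfolding x1_bounded_def
  proof (intro CollectI allI)
    fix n
    obtain N where "\<forall>m>N. X m n = 0" using X unfolding x1_bounded_def by blast
    then show "\<exists>N. \<forall>m>N. shift1 X m n = 0" by (intro exI[of _ "N + 1"]) (auto simp: shift1_def)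
  qed
next
  fix X c assume X: "X \<in> x1_bounded"
  show "scale_series c X \<in> x1_bounded" unfolding x1_bounded_def
  proof (intro CollectI allI)
    fix n
    obtain N where "\<forall>m>N. X m n = 0" using X unfolding x1_bounded_def by blast
    then show "\<exists>N. \<forall>m>N. scale_series c X m n = 0"
      by (intro exI[of _ N]) (auto simp: scale_series_def)
  qed
qed (auto simp: x1_bounded_def shift2_def)

lemma series_space_x2_bounded: "series_space x2_bounded"
proof (rule series_spaceI)
  fix X X' assume X: "X \<in> x2_bounded" "X' \<in> x2_bounded"
  show "X + X' \<in> x2_bounded" unfolding x2_bounded_def
  proof (intro CollectI allI)
    fix m
    obtain N N' where "\<forall>n>N. X m n = 0" "\<forall>n>N'. X' m n = 0"
      using X unfolding x2_bounded_def by blast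
    then show "\<exists>N. \<forall>n>N. (X + X') m n = 0" by (intro exI[of _ "max N N'"]) auto
  qed
next
  fix X assume X: "X \<in> x2_bounded"
  show "shift2 X \<in> x2_bounded" unfolding x2_bounded_def
  proof (intro CollectI allI)
    fix m
    obtain N where "\<forall>n>N. X m n = 0" using X unfolding x2_bounded_def by blast
    then show "\<exists>N. \<forall>n>N. shift2 X m n = 0" by (intro exI[of _ "N + 1"]) (auto simp: shift2_def)
  qed
next
  fix X c assume X: "X \<in> x2_bounded"
  show "scale_series c X \<in> x2_bounded" unfolding x2_bounded_def
  proof (intro CollectI allI)
    fix m
    obtain N where "\<forall>n>N. X m n = 0" using X unfolding x2_bounded_def by blast
    then show "\<exists>N. \<forall>n>N. scale_series c X m n = 0"
      by (intro exI[of _ N]) (auto simp: scale_series_def)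
  qed
qed (auto simp: x2_bounded_def shift1_def)

lemma series_space_uniformly_x1_bounded: "series_space uniformly_x1_bounded"
proof (rule series_spaceI)
  fix X X' assume "X \<in> uniformly_x1_bounded" "X' \<in> uniformly_x1_bounded"
  then obtain N N' where "\<forall>m>N. \<forall>n. X m n = 0" "\<forall>m>N'. \<forall>n. X' m n = 0"
    unfolding uniformly_x1_bounded_def by blast
  then show "X + X' \<in> uniformly_x1_bounded" unfolding uniformly_x1_bounded_def
    by (intro CollectI exI[of _ "max N N'"]) auto
next
  fix X assume "X \<in> uniformly_x1_bounded"
  then obtain N where "\<forall>m>N. \<forall>n. X m n = 0" unfolding uniformly_x1_bounded_def by blast
  then show "shift1 X \<in> uniformly_x1_bounded" unfolding uniformly_x1_bounded_def
    by (intro CollectI exI[of _ "N + 1"]) (auto simp: shift1_def)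
qed (auto simp: uniformly_x1_bounded_def scale_series_def shift2_def)

lemma series_space_uniformly_x2_bounded: "series_space uniformly_x2_bounded"
proof (rule series_spaceI)
  fix X X' assume "X \<in> uniformly_x2_bounded" "X' \<in> uniformly_x2_bounded"
  then obtain N N' where "\<forall>m. \<forall>n>N. X m n = 0" "\<forall>m. \<forall>n>N'. X' m n = 0"
    unfolding uniformly_x2_bounded_def by blast
  then show "X + X' \<in> uniformly_x2_bounded" unfolding uniformly_x2_bounded_def
    by (intro CollectI exI[of _ "max N N'"]) auto
next
  fix X assume "X \<in> uniformly_x2_bounded"
  then obtain N where "\<forall>m. \<forall>n>N. X m n = 0" unfolding uniformly_x2_bounded_def by blast
  then show "shift2 X \<in> uniformly_x2_bounded" unfolding uniformly_x2_bounded_def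
    by (intro CollectI exI[of _ "N + 1"]) (auto simp: shift2_def)
qed (auto simp: uniformly_x2_bounded_def scale_series_def shift1_def)

lemma series_space_x1_bounded_below: "series_space x1_bounded_below"
proof (rule series_spaceI)
  fix X X' assume "X \<in> x1_bounded_below" "X' \<in> x1_bounded_below"
  then obtain N N' where "\<forall>m<N. \<forall>n. X m n = 0" "\<forall>m<N'. \<forall>n. X' m n = 0"
    unfolding x1_bounded_below_def by blast
  then show "X + X' \<in> x1_bounded_below" unfolding x1_bounded_below_def
    by (intro CollectI exI[of _ "min N N'"]) auto
next
  fix X assume "X \<in> x1_bounded_below"
  then obtain N where "\<forall>m<N. \<forall>n. X m n = 0" unfolding x1_bounded_below_def by blast
  then show "shift1 X \<in> x1_bounded_below" unfolding x1_bounded_below_def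
    by (intro CollectI exI[of _ "N"]) (auto simp: shift1_def)
qed (auto simp: x1_bounded_below_def scale_series_def shift2_def)

lemmas series_space_jointly_bounded =
  series_space_Int[OF series_space_uniformly_x1_bounded series_space_uniformly_x2_bounded]

lemmas series_space_laurent_x0 =
  series_space_Int[OF series_space_x1_bounded_below series_space_x2_bounded]

section \<open>Cancellation of polynomials\<close>

lemma act_const: "act [:c:] X m n = (\<Sum>j\<le>degree c. coeff c j *s X m (n - int j))"
  by (simp add: act_def)

text \<open>\<open>W((x\<^sub>2\<^bsup>-1\<^esup>))\<close> is torsion-free over \<open>\<complex>[x\<^sub>2]\<close>: compare the highest exponents.\<close>
lemma row_eq_0:
  assumes c: "c \<noteq> 0" and act: "\<And>n. act [:c:] X m n = 0" and X: "X \<in> x2_bounded"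
  shows "X m n = 0"
proof -
  obtain N where N: "\<And>n. N < n \<Longrightarrow> X m n = 0"
    using X unfolding x2_bounded_def by blast
  show ?thesis
  proof (induction n rule: measure_induct_rule[where f = "\<lambda>n. nat (N + 1 - n)"])
    case (less n)
    show ?case
    proof (cases "n \<le> N")
      case True
      have "(\<Sum>j\<in>{..degree c} - {degree c}. coeff c j *s X m (n + int (degree c) - int j)) = 0"
        using less True by (intro sum.neutral) auto
      then have "act [:c:] X m (n + int (degree c)) = lead_coeff c *s X m n"
        unfolding act_const by (subst sum.remove[of _ "degree c"]) auto
      then show ?thesis using c act by simp
    qed (simp add: N)
  qed
qed

text \<open>A polynomial with nonzero constant term in \<open>x\<^sub>0\<close> does not change the lowest power of
  \<open>x\<^sub>0\<close> that occurs. This also bounds the order of poles later on.\<close>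
lemma lower_rows_eq_0:
  assumes p: "coeff p 0 \<noteq> 0" and X: "X \<in> laurent_x0"
    and act: "\<And>m n. m < M \<Longrightarrow> act p X m n = 0" and m: "m < M"
  shows "X m n = 0"
proof -
  obtain M0 where M0: "\<And>m n. m < M0 \<Longrightarrow> X m n = 0"
    using X unfolding x1_bounded_below_def by blast
  obtain c p' where pc: "p = pCons c p'" by (cases p)
  have "\<forall>n. X m n = 0" using m
  proof (induction m rule: measure_induct_rule[where f = "\<lambda>m. nat (m - M0 + 1)"])
    case (less m)
    have lower: "X i n = 0" if "i < m" for i n
    proof (cases "i < M0")
      case False
      then have "nat (i - M0 + 1) < nat (m - M0 + 1)" using that by linarith
      then show ?thesis using less that by auto
    qed (simp add: M0)
    have "act p' X (m - 1) n = 0" for n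
      unfolding act_def by (intro sum.neutral ballI) (simp add: lower)
    then have "act [:c:] X m n = 0" for n
      using act[OF less.prems, of n] by (simp add: pc act_pCons[of c p'] shift1_def)
    then show ?case using p pc X row_eq_0[of c X m] by auto
  qed
  then show ?thesis by simp
qed

lemma act_eq_0_cancel:
  assumes p: "p \<noteq> 0" and X: "X \<in> laurent_x0" and act: "act p X = 0"
  shows "X = 0"
proof -
  obtain q where q: "p = [:0, 1:] ^ order 0 p * q" "\<not> [:0, 1:] dvd q"
    using order_decomp[OF p, of 0] by auto
  have q0: "coeff q 0 \<noteq> 0"
    using q(2) poly_eq_0_iff_dvd[of q 0] by (simp add: poly_0_coeff_0)
  have shift_inj: "Z = 0" if "act ([:0, 1:] ^ k) Z = 0" for k Z
    using that
  proof (induction k)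
    case (Suc k)
    have 1: "shift1 (act ([:0, 1:] ^ k) Z) = 0"
      using Suc.prems by (simp only: power_Suc act_mult shift1_eq_act)
    have "act ([:0, 1:] ^ k) Z m n = 0" for m n
      using fun_cong[OF fun_cong[OF 1], of "m + 1" n] by (simp add: shift1_def)
    then show ?case by (intro Suc.IH ext) simp
  qed (simp add: act_1)
  have "act q X = 0"
    using act q(1) shift_inj[of "order 0 p" "act q X"] by (simp add: act_mult[symmetric])
  then have "X m n = 0" for m n
    by (intro lower_rows_eq_0[OF q0 X, of "m + 1"]) auto
  then show ?thesis by (intro ext) simp
qed

section \<open>The expansion along the diagonal and its residue\<close>

lemma act_monic_linear: "act [:c, 1:] X = act [:c:] X + shift1 X"
proof -
  have "act [:1:] X = X" using act_1[of X] unfolding one_pCons .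
  then show ?thesis unfolding act_pCons[of c "[:1:]"] by (simp only:)
qed

text \<open>The substitution \<open>x\<^sub>1 = x\<^sub>2 + x\<^sub>0\<close>; pointwise in \<open>w\<close> it is \<open>shift_subst\<close>.\<close>
definition expand_at_diagonal :: "'w series2 \<Rightarrow> 'w series2" where
  "expand_at_diagonal X = (\<lambda>i k. if i < 0 then 0
     else Sum_any (\<lambda>m. (of_int m gchoose nat i) *s X m (k - (m - i))))"

text \<open>Finite ranges of summation reduce the algebra of these infinite sums to that of finite
  ones. The endpoints are left free, so that sums coming from different series can be given a common
  range.\<close>
lemma expand_at_diagonal_eq_sum:
  assumes "\<And>m n. N < m \<or> N < n \<Longrightarrow> X m n = 0" "0 \<le> i" "L \<le> k + i - N" "N \<le> H"
  shows "expand_at_diagonal X i k =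
     (\<Sum>m\<in>{L..H}. (of_int m gchoose nat i) *s X m (k - (m - i)))"
proof -
  have "X m (k - (m - i)) = 0" if "m \<notin> {L..H}" for m
    using that assms by (intro assms(1)) auto
  then have "{m. (of_int m gchoose nat i) *s X m (k - (m - i)) \<noteq> 0} \<subseteq> {L..H}"
    by force
  then show ?thesis
    using assms(2) by (simp add: expand_at_diagonal_def Sum_any.expand_superset)
qed

lemma jointly_boundedE:
  assumes "X \<in> jointly_bounded"
  obtains N where "\<And>m n. N < m \<or> N < n \<Longrightarrow> X m n = 0"
proof -
  obtain N N' where "\<forall>m>N. \<forall>n. X m n = 0" "\<forall>m. \<forall>n>N'. X m n = 0"
    using assms unfolding uniformly_x1_bounded_def uniformly_x2_bounded_def by blast
  then show ?thesis by (intro that[of "max N N'"]) auto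
qed

lemma gbinomial_int_plus_1:
  "(of_int (m + 1) gchoose Suc k :: complex) = (of_int m gchoose k) + (of_int m gchoose Suc k)"
  using gbinomial_Suc_Suc[of "of_int m :: complex" k] by simp

lemma expand_at_diagonal_act:
  assumes X: "X \<in> jointly_bounded"
  shows "expand_at_diagonal (act p X) = act (poly2_shift p) (expand_at_diagonal X)"
  unfolding poly2_shift_def
proof (rule intertwine_act[OF series_space_jointly_bounded _ _ _ _ X])
  fix X X' :: "'w series2" assume "X \<in> jointly_bounded" "X' \<in> jointly_bounded"
  then obtain N N' where N: "\<And>m n. N < m \<or> N < n \<Longrightarrow> X m n = 0"
      and N': "\<And>m n. N' < m \<or> N' < n \<Longrightarrow> X' m n = 0"
    using jointly_boundedE by metis
  show "expand_at_diagonal (X + X') = expand_at_diagonal X + expand_at_diagonal X'"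
  proof (intro ext)
    fix i k
    let ?N = "max N N'" and ?S = "\<lambda>X. \<Sum>m\<in>{k + i - max N N'..max N N'}. (of_int m gchoose nat i) *s X m (k - (m - i))"
    have "i \<ge> 0 \<Longrightarrow> expand_at_diagonal (X + X') i k = ?S (X + X')"
      by (rule expand_at_diagonal_eq_sum[where N = ?N]) (auto simp: N N')
    moreover have "i \<ge> 0 \<Longrightarrow> expand_at_diagonal X i k = ?S X"
      by (rule expand_at_diagonal_eq_sum[where N = ?N]) (auto simp: N N')
    moreover have "i \<ge> 0 \<Longrightarrow> expand_at_diagonal X' i k = ?S X'"
      by (rule expand_at_diagonal_eq_sum[where N = ?N]) (auto simp: N N')
    ultimately show "expand_at_diagonal (X + X') i k =
        (expand_at_diagonal X + expand_at_diagonal X') i k"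
      by (cases "i < 0") (simp_all add: expand_at_diagonal_def scale_right_distrib sum.distrib)
  qed
next
  fix X :: "'w series2" and c assume "X \<in> jointly_bounded"
  then obtain N where N: "\<And>m n. N < m \<or> N < n \<Longrightarrow> X m n = 0"
    using jointly_boundedE by metis
  show "expand_at_diagonal (scale_series c X) = scale_series c (expand_at_diagonal X)"
  proof (intro ext)
    fix i k
    let ?S = "\<lambda>X. \<Sum>m\<in>{k + i - N..N}. (of_int m gchoose nat i) *s X m (k - (m - i))"
    have "i \<ge> 0 \<Longrightarrow> expand_at_diagonal (scale_series c X) i k = ?S (scale_series c X)"
      by (rule expand_at_diagonal_eq_sum[where N = N]) (auto simp: N scale_series_def)
    moreover have "i \<ge> 0 \<Longrightarrow> expand_at_diagonal X i k = ?S X"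
      by (rule expand_at_diagonal_eq_sum[where N = N]) (auto simp: N)
    ultimately show "expand_at_diagonal (scale_series c X) i k =
        scale_series c (expand_at_diagonal X) i k"
      by (cases "i < 0")
        (simp_all add: expand_at_diagonal_def scale_series_def scale_sum_right mult.commute)
  qed
next
  fix X :: "'w series2"
  show "expand_at_diagonal (shift2 X) = shift2 (expand_at_diagonal X)"
    by (simp add: expand_at_diagonal_def shift2_def fun_eq_iff algebra_simps)
next
  fix X :: "'w series2" assume "X \<in> jointly_bounded"
  then obtain N where N: "\<And>m n. N < m \<or> N < n \<Longrightarrow> X m n = 0"
    using jointly_boundedE by metis
  have N1: "shift1 X m n = 0" if "N + 1 < m \<or> N + 1 < n" for m n
    unfolding shift1_def using that by (intro N) linarith
  have "expand_at_diagonal (shift1 X) i k = expand_at_diagonal X (i - 1) k + expand_at_diagonal X i (k - 1)"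
    for i k
  proof (cases "i < 0")
    case False
    have "expand_at_diagonal (shift1 X) i k =
        (\<Sum>m\<in>{k + i - N - 1..N + 1}. (of_int m gchoose nat i) *s shift1 X m (k - (m - i)))"
      using False N1 by (intro expand_at_diagonal_eq_sum[where N = "N + 1"]) auto
    also have "\<dots> = (\<Sum>m\<in>{k + i - N - 2..N}. (of_int (m + 1) gchoose nat i) *s X m (k - 1 - (m - i)))"
    proof (rule sum.reindex_bij_witness[of _ "\<lambda>m. m + 1" "\<lambda>m. m - 1"])
      fix m
      have eq: "k - 1 - (m - 1 - i) = k - (m - i)" by linarith
      show "(of_int (m - 1 + 1) gchoose nat i) *s X (m - 1) (k - 1 - (m - 1 - i)) =
          (of_int m gchoose nat i) *s shift1 X m (k - (m - i))"
        by (simp only: shift1_def eq diff_add_cancel)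
    qed auto
    finally have 1: "expand_at_diagonal (shift1 X) i k = \<dots>" .
    have 2: "expand_at_diagonal X i (k - 1) =
        (\<Sum>m\<in>{k + i - N - 2..N}. (of_int m gchoose nat i) *s X m (k - 1 - (m - i)))"
      using False by (intro expand_at_diagonal_eq_sum[where N = N]) (auto simp: N)
    show ?thesis
    proof (cases "i = 0")
      case True
      then show ?thesis unfolding 1 2 by (simp add: expand_at_diagonal_def)
    next
      case i: False
      define i' where "i' = nat (i - 1)"
      have i': "nat i = Suc i'" "nat (i - 1) = i'"
        using i False by (auto simp: i'_def)
      have 3: "expand_at_diagonal X (i - 1) k =
          (\<Sum>m\<in>{k + i - N - 2..N}. (of_int m gchoose nat (i - 1)) *s X m (k - (m - (i - 1))))"
        using False i by (intro expand_at_diagonal_eq_sum[where N = N]) (auto simp: N)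
      have "k - 1 - (m - i) = k - (m - (i - 1))" for m by linarith
      then show ?thesis unfolding 1 2 3 i'
        by (simp only: gbinomial_int_plus_1 scale_left_distrib sum.distrib)
    qed
  qed (simp add: expand_at_diagonal_def)
  moreover have "act [:[:0, 1:], 1:] (expand_at_diagonal X) =
      shift2 (expand_at_diagonal X) + shift1 (expand_at_diagonal X)"
    by (simp only: act_monic_linear shift2_eq_act)
  ultimately show "expand_at_diagonal (shift1 X) = act [:[:0, 1:], 1:] (expand_at_diagonal X)"
    by (simp add: fun_eq_iff shift1_def shift2_def add.commute)
qed

text \<open>If \<open>Z = \<Sum>i. Z\<^sub>i(x\<^sub>2) x\<^sub>0\<^sup>i\<close>, this is
  \<open>\<Sum>j\<ge>0. Z\<^bsub>-j-1\<^esub>(x\<^sub>2) (1/j!) (\<partial>/\<partial>x\<^sub>2)\<^sup>j x\<^sub>1\<^bsup>-1\<^esup> \<delta>(x\<^sub>2/x\<^sub>1)\<close>,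
  the series supported on the diagonal whose coefficients are the polar part of \<open>Z\<close>.\<close>
definition delta_sum :: "'w series2 \<Rightarrow> 'w series2" where
  "delta_sum Z = (\<lambda>m n. Sum_any (\<lambda>j::nat.
     (of_int (- m - 1) gchoose j) *s Z (- int j - 1) (n + m + 1 + int j)))"

lemma delta_sum_eq_sum:
  assumes "\<And>i n. i < - int k \<Longrightarrow> Z i n = 0"
  shows "delta_sum Z m n =
     (\<Sum>j<k. (of_int (- m - 1) gchoose j) *s Z (- int j - 1) (n + m + 1 + int j))"
proof -
  have "Z (- int j - 1) (n + m + 1 + int j) = 0" if "j \<notin> {..<k}" for j
    using that by (intro assms) auto
  then have "{j. (of_int (- m - 1) gchoose j) *s Z (- int j - 1) (n + m + 1 + int j) \<noteq> 0} \<subseteq> {..<k}"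
    by force
  then show ?thesis by (simp add: delta_sum_def Sum_any.expand_superset)
qed

lemma x1_bounded_belowE:
  assumes "Z \<in> laurent_x0"
  obtains k where "\<And>i n. i < - int k \<Longrightarrow> Z i n = 0"
proof -
  obtain M where "\<forall>i<M. \<forall>n. Z i n = 0"
    using assms unfolding x1_bounded_below_def by blast
  then show ?thesis by (intro that[of "nat (- M)"]) (auto split: if_splits)
qed

text \<open>Multiplying the \<open>j\<close>th derivative of the delta function by \<open>x\<^sub>1 - x\<^sub>2\<close> gives the
  \<open>(j - 1)\<close>st one, by Pascal's rule, just as multiplication by \<open>x\<^sub>0\<close> lowers the order of a
  pole.\<close>
lemma delta_sum_act:
  assumes Z: "Z \<in> laurent_x0"
  shows "delta_sum (act p Z) = act (pcompose p [:- [:0, 1:], 1:]) (delta_sum Z)"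
proof (rule intertwine_act[OF series_space_laurent_x0 _ _ _ _ Z])
  fix Z Z' :: "'w series2" assume "Z \<in> laurent_x0" "Z' \<in> laurent_x0"
  then obtain k k' where k: "\<And>i n. i < - int k \<Longrightarrow> Z i n = 0" and k': "\<And>i n. i < - int k' \<Longrightarrow> Z' i n = 0"
    using x1_bounded_belowE by metis
  show "delta_sum (Z + Z') = delta_sum Z + delta_sum Z'"
  proof (intro ext)
    fix m n
    let ?k = "max k k'"
    let ?S = "\<lambda>Z. \<Sum>j<?k. (of_int (- m - 1) gchoose j) *s Z (- int j - 1) (n + m + 1 + int j)"
    have "delta_sum (Z + Z') m n = ?S (Z + Z')" "delta_sum Z m n = ?S Z" "delta_sum Z' m n = ?S Z'"
      by (intro delta_sum_eq_sum; simp add: k k')+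
    then show "delta_sum (Z + Z') m n = (delta_sum Z + delta_sum Z') m n"
      by (simp add: scale_right_distrib sum.distrib)
  qed
next
  fix Z :: "'w series2" and c assume "Z \<in> laurent_x0"
  then obtain k where k: "\<And>i n. i < - int k \<Longrightarrow> Z i n = 0"
    using x1_bounded_belowE by metis
  show "delta_sum (scale_series c Z) = scale_series c (delta_sum Z)"
  proof (intro ext)
    fix m n
    let ?S = "\<lambda>Z. \<Sum>j<k. (of_int (- m - 1) gchoose j) *s Z (- int j - 1) (n + m + 1 + int j)"
    have "delta_sum (scale_series c Z) m n = ?S (scale_series c Z)" "delta_sum Z m n = ?S Z"
      by (intro delta_sum_eq_sum; simp add: k scale_series_def)+
    then show "delta_sum (scale_series c Z) m n = scale_series c (delta_sum Z) m n"
      by (simp add: scale_series_def scale_sum_right mult.commute)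
  qed
next
  fix Z :: "'w series2"
  show "delta_sum (shift2 Z) = shift2 (delta_sum Z)"
    by (simp add: delta_sum_def shift2_def fun_eq_iff algebra_simps)
next
  fix Z :: "'w series2" assume "Z \<in> laurent_x0"
  then obtain k where k: "\<And>i n. i < - int k \<Longrightarrow> Z i n = 0"
    using x1_bounded_belowE by metis
  have "delta_sum (shift1 Z) m n + delta_sum Z m (n - 1) = delta_sum Z (m - 1) n" for m n
  proof -
    let ?b = "\<lambda>j. of_int (- m - 1) gchoose j :: complex" and ?z = "\<lambda>j. Z (- int j - 1) (n + m + int j)"
    have "delta_sum Z (m - 1) n =
        (\<Sum>j<Suc k. (of_int (- (m - 1) - 1) gchoose j) *s Z (- int j - 1) (n + (m - 1) + 1 + int j))"
      by (intro delta_sum_eq_sum) (simp add: k)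
    also have "\<dots> = (\<Sum>j<Suc k. (of_int ((- m - 1) + 1) gchoose j) *s ?z j)"
      by (simp add: algebra_simps)
    also have "\<dots> = ?z 0 + (\<Sum>j<k. (?b j + ?b (Suc j)) *s ?z (Suc j))"
      unfolding sum.lessThan_Suc_shift gbinomial_int_plus_1 by simp
    also have "\<dots> = (\<Sum>j<k. ?b j *s ?z (Suc j)) + (\<Sum>j<Suc k. ?b j *s ?z j)"
      unfolding sum.lessThan_Suc_shift by (simp add: scale_left_distrib sum.distrib algebra_simps)
    also have "(\<Sum>j<Suc k. ?b j *s ?z j) = delta_sum Z m (n - 1)"
      by (subst delta_sum_eq_sum[of "Suc k"]) (auto simp: k algebra_simps)
    also have "(\<Sum>j<k. ?b j *s ?z (Suc j)) = delta_sum (shift1 Z) m n"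
      by (subst delta_sum_eq_sum[of k]) (auto simp: k shift1_def algebra_simps)
    finally show ?thesis by simp
  qed
  then have "delta_sum (shift1 Z) + shift2 (delta_sum Z) = shift1 (delta_sum Z)"
    by (simp add: fun_eq_iff shift1_def shift2_def)
  moreover have "act [:- [:0, 1:], 1:] (delta_sum Z) = - shift2 (delta_sum Z) + shift1 (delta_sum Z)"
  proof -
    have "act [:- [:0, 1:]:] (delta_sum Z) = - act [:[:0, 1:]:] (delta_sum Z)"
      using series.scale_minus_left[of "[:[:0, 1:]:]" "delta_sum Z"]
      by (simp only: minus_pCons minus_zero)
    then show ?thesis
      by (simp only: act_monic_linear shift2_eq_act)
  qed
  ultimately show "delta_sum (shift1 Z) = act [:- [:0, 1:], 1:] (delta_sum Z)"
    by (simp add: eq_diff_eq[symmetric])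
qed

text \<open>Read backwards: \<open>x\<^sub>1\<close> acts on the delta series as \<open>x\<^sub>2 + x\<^sub>0\<close> acts on \<open>Z\<close>.\<close>
lemma delta_sum_act_shift:
  assumes "Z \<in> laurent_x0"
  shows "delta_sum (act (poly2_shift p) Z) = act p (delta_sum Z)"
proof -
  have "pcompose [:[:0, 1:], 1:] [:- [:0, 1:], 1:] = [:0, 1 :: complex poly:]"
    by (simp add: pcompose_pCons)
  then show ?thesis
    by (simp only: delta_sum_act[OF assms] poly2_shift_def pcompose_assoc[symmetric] pcompose_idR)
qed

end

section \<open>Affine substitution in the first variable\<close>

text \<open>\<open>g(x)\<^bsup>n+1\<^esup> = g(x) g(x)\<^sup>n\<close>.\<close>

lemma affine_power_plus_1:
  assumes g: "degree g = 1"
  shows "affine_power g (n + 1) k = coeff g 1 * affine_power g n (k - 1) + coeff g 0 * affine_power g n k"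
proof -
  have a: "coeff g 1 \<noteq> 0" using g leading_coeff_neq_0[of g] by (metis degree_0 zero_neq_one)
  have pow: "coeff g 1 * coeff g 1 powi (k - 1) = coeff g 1 powi k"
    using a power_int_add_1'[of "coeff g 1" "k - 1"] by simp
  consider "k > n + 1" | "k = n + 1" | "k \<le> n" by linarith
  then show ?thesis
  proof cases
    case 2
    then show ?thesis using pow by (simp add: affine_power_def)
  next
    case 3
    define i where "i = nat (n - k)"
    have i: "nat (n - (k - 1)) = Suc i" "nat (n + 1 - k) = Suc i" "nat (n - k) = i"
      using 3 by (auto simp: i_def)
    have "affine_power g (n + 1) k =
        (of_int (n + 1) gchoose Suc i) * (coeff g 1 powi k) * coeff g 0 ^ Suc i"
      using 3 i by (simp add: affine_power_def)
    also have "of_int (n + 1) gchoose Suc i = (of_int n gchoose i) + (of_int n gchoose Suc i :: complex)"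
      using gbinomial_Suc_Suc[of "of_int n :: complex" i] by simp
    finally show ?thesis
      using 3 i pow[symmetric] by (simp add: affine_power_def algebra_simps)
  qed (simp add: affine_power_def)
qed

context complex_vector_space
begin

text \<open>The substitution \<open>x\<^sub>1 \<mapsto> g(x\<^sub>1)\<close>. Since \<open>g(x)\<^sup>l\<close> has only exponents at most
  \<open>l\<close>, it is defined on \<open>x1_bounded\<close>.\<close>
definition affine_compose :: "complex poly \<Rightarrow> 'w series2 \<Rightarrow> 'w series2" where
  "affine_compose g X = (\<lambda>m n. Sum_any (\<lambda>l. affine_power g l m *s X l n))"

lemma affine_compose_eq_sum:
  assumes "\<And>l. N < l \<Longrightarrow> X l n = 0" "L \<le> m"
  shows "affine_compose g X m n = (\<Sum>l\<in>{L..N}. affine_power g l m *s X l n)"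
proof -
  have "{l. affine_power g l m *s X l n \<noteq> 0} \<subseteq> {L..N}"
    using assms by (force simp: affine_power_def split: if_splits)
  then show ?thesis by (simp add: affine_compose_def Sum_any.expand_superset)
qed

lemma affine_compose_add:
  assumes "X \<in> x1_bounded" "X' \<in> x1_bounded"
  shows "affine_compose g (X + X') = affine_compose g X + affine_compose g X'"
proof (intro ext)
  fix m n
  obtain N N' where N: "\<forall>l>N. X l n = 0" "\<forall>l>N'. X' l n = 0"
    using assms unfolding x1_bounded_def by blast
  let ?S = "\<lambda>X. \<Sum>l\<in>{m..max N N'}. affine_power g l m *s X l n"
  have "affine_compose g (X + X') m n = ?S (X + X')"
    "affine_compose g X m n = ?S X" "affine_compose g X' m n = ?S X'"
    using N by (intro affine_compose_eq_sum; simp)+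
  then show "affine_compose g (X + X') m n = (affine_compose g X + affine_compose g X') m n"
    by (simp add: scale_right_distrib sum.distrib)
qed

lemma affine_compose_scale:
  assumes "X \<in> x1_bounded"
  shows "affine_compose g (scale_series c X) = scale_series c (affine_compose g X)"
proof (intro ext)
  fix m n
  obtain N where N: "\<forall>l>N. X l n = 0"
    using assms unfolding x1_bounded_def by blast
  let ?S = "\<lambda>X. \<Sum>l\<in>{m..N}. affine_power g l m *s X l n"
  have "affine_compose g (scale_series c X) m n = ?S (scale_series c X)" "affine_compose g X m n = ?S X"
    using N by (intro affine_compose_eq_sum; simp add: scale_series_def)+
  then show "affine_compose g (scale_series c X) m n = scale_series c (affine_compose g X) m n"
    by (simp add: scale_series_def scale_sum_right mult.commute)
qed

lemma affine_compose_act: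
  assumes g: "degree g = 1" and X: "X \<in> x1_bounded"
  shows "affine_compose g (act p X) =
     act (pcompose p [:[:coeff g 0:], [:coeff g 1:]:]) (affine_compose g X)"
proof (rule intertwine_act[OF series_space_x1_bounded _ _ _ _ X])
  fix X :: "'w series2" assume X: "X \<in> x1_bounded"
  have "affine_compose g (shift1 X) m n =
      coeff g 1 *s affine_compose g X (m - 1) n + coeff g 0 *s affine_compose g X m n" for m n
  proof -
    obtain N where N: "\<forall>l>N. X l n = 0"
      using X unfolding x1_bounded_def by blast
    have "affine_compose g (shift1 X) m n = (\<Sum>l\<in>{m..N + 1}. affine_power g l m *s shift1 X l n)"
      using N by (intro affine_compose_eq_sum) (auto simp: shift1_def)
    also have "\<dots> = (\<Sum>l\<in>{m - 1..N}. affine_power g (l + 1) m *s X l n)"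
      by (rule sum.reindex_bij_witness[of _ "\<lambda>l. l + 1" "\<lambda>l. l - 1"]) (auto simp: shift1_def)
    also have "\<dots> = coeff g 1 *s (\<Sum>l\<in>{m - 1..N}. affine_power g l (m - 1) *s X l n) +
        coeff g 0 *s (\<Sum>l\<in>{m - 1..N}. affine_power g l m *s X l n)"
      by (simp add: affine_power_plus_1[OF g] scale_sum_right sum.distrib scale_left_distrib)
    also have "(\<Sum>l\<in>{m - 1..N}. affine_power g l (m - 1) *s X l n) = affine_compose g X (m - 1) n"
      using N by (intro affine_compose_eq_sum[symmetric]) auto
    also have "(\<Sum>l\<in>{m - 1..N}. affine_power g l m *s X l n) = affine_compose g X m n"
      using N by (intro affine_compose_eq_sum[symmetric]) auto
    finally show ?thesis .
  qed
  moreover have "act [:[:coeff g 0:], [:coeff g 1:]:] X' =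
      scale_series (coeff g 0) X' + shift1 (scale_series (coeff g 1) X')" for X'
    unfolding act_pCons[of _ "[:[:coeff g 1:]:]"] scale_series_eq_act by (rule refl)
  ultimately show "affine_compose g (shift1 X) =
      act [:[:coeff g 0:], [:coeff g 1:]:] (affine_compose g X)"
    by (simp add: fun_eq_iff shift1_def scale_series_def)
next
  fix X :: "'w series2"
  show "affine_compose g (shift2 X) = shift2 (affine_compose g X)"
    by (simp add: affine_compose_def shift2_def)
qed (rule affine_compose_add affine_compose_scale; assumption)+

section \<open>Difference of the two expansions of a quotient\<close>

lemma act_diagonal: "act [:- [:0, 1:], 1:] X = shift1 X - shift2 X"
proof -
  have "act [:- [:0, 1:]:] X = - act [:[:0, 1:]:] X"
    using series.scale_minus_left[of "[:[:0, 1:]:]" X] by (simp only: minus_pCons minus_zero)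
  then have "act [:- [:0, 1:], 1:] X = - shift2 X + shift1 X"
    by (simp only: act_monic_linear shift2_eq_act)
  then show ?thesis by (simp only: uminus_add_conv_diff)
qed

lemma act_diagonal_apply: "act [:- [:0, 1:], 1:] X m n = X (m - 1) n - X m (n - 1)"
  unfolding act_diagonal by (simp add: shift1_def shift2_def)

text \<open>Along a line \<open>m + n = const\<close> a solution is constant, and the bound makes it vanish far
  out. Hence division by powers of \<open>x\<^sub>1 - x\<^sub>2\<close> is unique in either of the two regions.\<close>
lemma diagonal_torsion_x2:
  assumes X: "X \<in> uniformly_x2_bounded" and act: "act [:- [:0, 1:], 1:] X = 0"
  shows "X = 0"
proof -
  obtain N where N: "\<And>m n. N < n \<Longrightarrow> X m n = 0"
    using X unfolding uniformly_x2_bounded_def by blast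
  have step: "X m n = X (m - 1) (n + 1)" for m n
    using act_diagonal_apply[of X m "n + 1"] act by simp
  have *: "X m n = X (m - int i) (n + int i)" for m n i
  proof (induction i)
    case (Suc i)
    then show ?case using step[of "m - int i" "n + int i"] by (simp add: algebra_simps)
  qed simp
  have "X m n = 0" for m n
    unfolding *[of m n "nat (N + 1 - n)"] by (intro N) linarith
  then show ?thesis by (intro ext) simp
qed

lemma diagonal_torsion_x1:
  assumes X: "X \<in> uniformly_x1_bounded" and act: "act [:- [:0, 1:], 1:] X = 0"
  shows "X = 0"
proof -
  obtain N where N: "\<And>m n. N < m \<Longrightarrow> X m n = 0"
    using X unfolding uniformly_x1_bounded_def by blast
  have step: "X m n = X (m + 1) (n - 1)" for m n
    using act_diagonal_apply[of X "m + 1" n] act by simp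
  have *: "X m n = X (m + int i) (n - int i)" for m n i
  proof (induction i)
    case (Suc i)
    then show ?case using step[of "m + int i" "n - int i"] by (simp add: algebra_simps)
  qed simp
  have "X m n = 0" for m n
    unfolding *[of m n "nat (N + 1 - m)"] by (intro N) linarith
  then show ?thesis by (intro ext) simp
qed

text \<open>The contribution of the coefficient of \<open>x\<^sub>1\<^sup>l\<close> in \<open>F\<close> to the coefficient of
  \<open>x\<^sub>1\<^sup>m x\<^sub>2\<^sup>n\<close> in \<open>F / (x\<^sub>1 - x\<^sub>2)\<^bsup>r+1\<^esup>\<close>, up to sign. The same expression serves both
  regions: the expansion for large \<open>x\<^sub>1\<close> sums it over \<open>l > m\<close>, and the one for large
  \<open>x\<^sub>2\<close> is minus the sum over \<open>l \<le> m\<close>.\<close>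
definition residue_summand :: "nat \<Rightarrow> 'w series2 \<Rightarrow> int \<Rightarrow> int \<Rightarrow> int \<Rightarrow> 'w" where
  "residue_summand r F m n l = (of_int (l - m - 1) gchoose r) *s F l (n + m + 1 + int r - l)"

text \<open>Multiplication by \<open>x\<^sub>1 - x\<^sub>2\<close> lowers the exponent of the denominator by one (Pascal's
  rule).\<close>
lemma residue_summand_diff:
  "residue_summand (Suc r) F (m - 1) n l - residue_summand (Suc r) F m (n - 1) l = residue_summand r F m n l"
proof -
  have *: "of_int (l - (m - 1) - 1) = of_int (l - m - 1) + (1 :: complex)" by simp
  have "(of_int (l - (m - 1) - 1) gchoose Suc r :: complex) - (of_int (l - m - 1) gchoose Suc r)
      = (of_int (l - m - 1) gchoose r)"
    unfolding * gbinomial_Suc_Suc by simp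
  moreover have "n + (m - 1) + 1 + int (Suc r) - l = n + m + 1 + int r - l"
    "n - 1 + m + 1 + int (Suc r) - l = n + m + 1 + int r - l" by auto
  ultimately show ?thesis
    unfolding residue_summand_def by (simp only: scale_left_diff_distrib[symmetric])
qed

lemma residue_summand_0_diff:
  "residue_summand 0 F (m - 1) n l = residue_summand 0 F m (n - 1) l"
proof -
  have "n + (m - 1) + 1 + int 0 - l = n - 1 + m + 1 + int 0 - l" by auto
  then show ?thesis unfolding residue_summand_def by (simp only: gbinomial_0)
qed

text \<open>The next two facts concern the boundary index \<open>l = m\<close>, where the ranges of summation
  for \<open>m\<close> and \<open>m - 1\<close> differ: it contributes nothing unless the denominator is
  \<open>x\<^sub>1 - x\<^sub>2\<close> itself, and then it produces \<open>F\<close>.\<close>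
lemma residue_summand_eq_0: "residue_summand (Suc r) F (m - 1) n m = 0"
  unfolding residue_summand_def by simp

lemma residue_summand_0_eq: "residue_summand 0 F (m - 1) n m = F m n"
  unfolding residue_summand_def by simp

text \<open>The stated sum is a solution by the recursion above, and the solution is unique.\<close>
lemma division_at_x2_infinity:
  assumes N: "\<And>m n. N < m \<or> N < n \<Longrightarrow> F m n = 0"
    and A: "A \<in> uniformly_x2_bounded" "act ([:- [:0, 1:], 1:] ^ Suc r) A = F"
  shows "A m n = - (\<Sum>l\<in>{n + m + 1 + int r - N..m}. residue_summand r F m n l)"
proof -
  define U where "U = (\<lambda>r m n. \<Sum>l\<in>{n + m + 1 + int r - N..m}. residue_summand r F m n l)"
  have U_bounded: "U r \<in> uniformly_x2_bounded" for r
    unfolding uniformly_x2_bounded_def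
  proof (intro CollectI exI allI impI)
    fix m n assume "N < n"
    then show "U r m n = 0"
      unfolding U_def by simp
  qed
  have U_Suc: "act [:- [:0, 1:], 1:] (U (Suc r)) = U r" for r
  proof (intro ext)
    fix m n
    let ?L = "n + m + 1 + int r - N"
    have "U (Suc r) (m - 1) n = (\<Sum>l\<in>{?L..m}. residue_summand (Suc r) F (m - 1) n l)"
      unfolding U_def
    proof (rule sum.mono_neutral_left)
      have "l = m" if "l \<in> {?L..m} - {n + (m - 1) + 1 + int (Suc r) - N..m - 1}" for l
        using that by auto
      then show "\<forall>l\<in>{?L..m} - {n + (m - 1) + 1 + int (Suc r) - N..m - 1}.
          residue_summand (Suc r) F (m - 1) n l = 0"
        using residue_summand_eq_0 by metis
    qed auto
    moreover have "U (Suc r) m (n - 1) = (\<Sum>l\<in>{?L..m}. residue_summand (Suc r) F m (n - 1) l)"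
      unfolding U_def by (rule sum.cong) auto
    ultimately show "act [:- [:0, 1:], 1:] (U (Suc r)) m n = U r m n"
      unfolding act_diagonal_apply by (simp add: U_def sum_subtractf[symmetric] residue_summand_diff)
  qed
  have U_0: "act [:- [:0, 1:], 1:] (U 0) = - F"
  proof (intro ext)
    fix m n
    let ?L = "n + m - N"
    have 1: "U 0 (m - 1) n = (\<Sum>l\<in>{?L..m - 1}. residue_summand 0 F (m - 1) n l)"
      unfolding U_def by (rule sum.cong) auto
    have 2: "U 0 m (n - 1) = (\<Sum>l\<in>{?L..m}. residue_summand 0 F (m - 1) n l)"
      unfolding U_def by (rule sum.cong) (auto simp: residue_summand_0_diff)
    show "act [:- [:0, 1:], 1:] (U 0) m n = (- F) m n"
    proof (cases "n \<le> N")
      case True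
      then have "{?L..m} = insert m {?L..m - 1}" by auto
      then show ?thesis
        unfolding act_diagonal_apply 1 2 by (simp add: residue_summand_0_eq)
    next
      case False
      then show ?thesis unfolding act_diagonal_apply 1 2 by (simp add: N)
    qed
  qed
  have "A = - U r" if "A \<in> uniformly_x2_bounded" "act ([:- [:0, 1:], 1:] ^ Suc r) A = F" for A r
    using that
  proof (induction r arbitrary: A)
    case 0
    have act: "act [:- [:0, 1:], 1:] (A + U 0) = 0"
    proof -
      have "act [:- [:0, 1:], 1:] A = F"
        using 0(2) by (simp only: power_one_right One_nat_def[symmetric])
      then show ?thesis
        by (intro trans[OF act_add_right]) (simp only: U_0 right_minus)
    qed
    have "A + U 0 = 0"
      by (rule diagonal_torsion_x2[OF series_spaceD(2)[OF series_space_uniformly_x2_bounded 0(1) U_bounded] act])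
    then show ?case by (rule iffD2[OF eq_neg_iff_add_eq_0])
  next
    case (Suc r)
    let ?A = "act [:- [:0, 1:], 1:] A"
    have "?A = - U r"
    proof (rule Suc.IH)
      show "?A \<in> uniformly_x2_bounded"
        by (intro series_space_act series_space_uniformly_x2_bounded Suc.prems)
      show "act ([:- [:0, 1:], 1:] ^ Suc r) ?A = F"
        using Suc.prems(2) unfolding power_Suc2[of _ "Suc r"] act_mult .
    qed
    then have act: "act [:- [:0, 1:], 1:] (A + U (Suc r)) = 0"
      by (intro trans[OF act_add_right]) (simp only: U_Suc left_minus)
    have "A + U (Suc r) = 0"
      by (rule diagonal_torsion_x2[OF series_spaceD(2)[OF series_space_uniformly_x2_bounded Suc.prems(1) U_bounded] act])
    then show ?case by (rule iffD2[OF eq_neg_iff_add_eq_0])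
  qed
  from this[OF A] have "A m n = (- U r) m n" by (simp only:)
  then show ?thesis by (simp only: U_def fun_Compl_def)
qed

lemma division_at_x1_infinity:
  assumes N: "\<And>m n. N < m \<or> N < n \<Longrightarrow> F m n = 0"
    and B: "B \<in> uniformly_x1_bounded" "act ([:- [:0, 1:], 1:] ^ Suc r) B = F"
  shows "B m n = (\<Sum>l\<in>{m + 1..N}. residue_summand r F m n l)"
proof -
  define U where "U = (\<lambda>r m n. \<Sum>l\<in>{m + 1..N}. residue_summand r F m n l)"
  have U_bounded: "U r \<in> uniformly_x1_bounded" for r
    unfolding uniformly_x1_bounded_def
  proof (intro CollectI exI allI impI)
    fix m n assume "N < m"
    then show "U r m n = 0" by (simp add: U_def)
  qed
  have U_Suc: "act [:- [:0, 1:], 1:] (U (Suc r)) = U r" for r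
  proof (intro ext)
    fix m n
    have "U (Suc r) (m - 1) n = (\<Sum>l\<in>{m + 1..N}. residue_summand (Suc r) F (m - 1) n l)"
      unfolding U_def
    proof (rule sum.mono_neutral_right)
      have "l = m" if "l \<in> {m - 1 + 1..N} - {m + 1..N}" for l
        using that by auto
      then show "\<forall>l\<in>{m - 1 + 1..N} - {m + 1..N}. residue_summand (Suc r) F (m - 1) n l = 0"
        using residue_summand_eq_0 by metis
    qed auto
    then show "act [:- [:0, 1:], 1:] (U (Suc r)) m n = U r m n"
      unfolding act_diagonal_apply by (simp add: U_def sum_subtractf[symmetric] residue_summand_diff)
  qed
  have U_0: "act [:- [:0, 1:], 1:] (U 0) = F"
  proof (intro ext)
    fix m n
    show "act [:- [:0, 1:], 1:] (U 0) m n = F m n"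
    proof (cases "m \<le> N")
      case True
      then have "{m - 1 + 1..N} = insert m {m + 1..N}" by auto
      then show ?thesis
        unfolding act_diagonal_apply U_def
        by (simp add: residue_summand_0_eq residue_summand_0_diff[symmetric])
    next
      case False
      then show ?thesis unfolding act_diagonal_apply U_def by (simp add: N)
    qed
  qed
  have "B = U r" if "B \<in> uniformly_x1_bounded" "act ([:- [:0, 1:], 1:] ^ Suc r) B = F" for B r
    using that
  proof (induction r arbitrary: B)
    case 0
    have 1: "act [:- [:0, 1:], 1:] B = F"
      using 0(2) by (simp only: power_one_right One_nat_def[symmetric])
    have act: "act [:- [:0, 1:], 1:] (B - U 0) = 0"
      by (rule trans[OF series.scale_right_diff_distrib]) (simp only: 1 U_0 diff_self)
    have "B - U 0 = 0"
      by (rule diagonal_torsion_x1[OF series_space_diff[OF series_space_uniformly_x1_bounded 0(1) U_bounded] act])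
    then show ?case by (simp only: right_minus_eq)
  next
    case (Suc r)
    let ?B = "act [:- [:0, 1:], 1:] B"
    have "?B = U r"
    proof (rule Suc.IH)
      show "?B \<in> uniformly_x1_bounded"
        by (intro series_space_act series_space_uniformly_x1_bounded Suc.prems)
      show "act ([:- [:0, 1:], 1:] ^ Suc r) ?B = F"
        using Suc.prems(2) unfolding power_Suc2[of _ "Suc r"] act_mult .
    qed
    then have act: "act [:- [:0, 1:], 1:] (B - U (Suc r)) = 0"
      by (intro trans[OF series.scale_right_diff_distrib]) (simp only: U_Suc diff_self)
    have "B - U (Suc r) = 0"
      by (rule diagonal_torsion_x1[OF series_space_diff[OF series_space_uniformly_x1_bounded Suc.prems(1) U_bounded] act])
    then show ?case by (simp only: right_minus_eq)
  qed
  from this[OF B] have "B m n = U r m n" by (simp only:)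
  then show ?thesis by (simp only: U_def)
qed

text \<open>The difference of the two expansions is the sum of \<open>residue_summand\<close> over all \<open>l\<close>, and
  expanding \<open>binomial(l - m - 1, r)\<close> by Vandermonde's identity turns it into the Taylor coefficients
  of \<open>F\<close> on the diagonal, which are the polar coefficients of \<open>Z = F(x\<^sub>2 + x\<^sub>0, x\<^sub>2) / x\<^sub>0\<^sup>k\<close>.\<close>
lemma difference_of_expansions:
  assumes F: "F \<in> jointly_bounded"
    and A: "A \<in> uniformly_x2_bounded" "act ([:- [:0, 1:], 1:] ^ k) A = F"
    and B: "B \<in> uniformly_x1_bounded" "act ([:- [:0, 1:], 1:] ^ k) B = F"
    and Z: "\<And>i n. Z i n = expand_at_diagonal F (i + int k) n"
  shows "A - B = - delta_sum Z"
proof (intro ext)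
  fix m n
  obtain N where N: "\<And>m n. N < m \<or> N < n \<Longrightarrow> F m n = 0"
    using jointly_boundedE[OF F] by metis
  have Z0: "Z i n = 0" if "i < - int k" for i n
    using that by (simp add: Z expand_at_diagonal_def)
  show "(A - B) m n = (- delta_sum Z) m n"
  proof (cases k)
    case 0
    have "delta_sum Z m n = 0"
      using Z0 0 by (subst delta_sum_eq_sum[of 0]) auto
    then show ?thesis using A(2) B(2) 0 by (simp add: act_1)
  next
    case (Suc r)
    \<comment> \<open>A range that contains the supports of all sums involved and has \<open>m\<close> as a cutting point.\<close>
    define L where "L = min (n + m + 1 + int r - N) m"
    define H where "H = max N m"
    have "A m n = - (\<Sum>l\<in>{n + m + 1 + int r - N..m}. residue_summand r F m n l)"
      by (rule division_at_x2_infinity[of N F A r, OF N A(1) A(2)[unfolded Suc]])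
    also have "(\<Sum>l\<in>{n + m + 1 + int r - N..m}. residue_summand r F m n l) =
        (\<Sum>l\<in>{L..m}. residue_summand r F m n l)"
      by (rule sum.mono_neutral_left) (auto simp: L_def residue_summand_def N)
    finally have A': "A m n = - (\<Sum>l\<in>{L..m}. residue_summand r F m n l)" .
    have "B m n = (\<Sum>l\<in>{m + 1..N}. residue_summand r F m n l)"
      by (rule division_at_x1_infinity[of N F B r, OF N B(1) B(2)[unfolded Suc]])
    also have "\<dots> = (\<Sum>l\<in>{m + 1..H}. residue_summand r F m n l)"
      by (rule sum.mono_neutral_left) (auto simp: H_def residue_summand_def N)
    finally have "(A - B) m n = - ((\<Sum>l\<in>{L..m}. residue_summand r F m n l) +
        (\<Sum>l\<in>{m + 1..H}. residue_summand r F m n l))"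
      using A' by simp
    also have "(\<Sum>l\<in>{L..m}. residue_summand r F m n l) + (\<Sum>l\<in>{m + 1..H}. residue_summand r F m n l)
        = (\<Sum>l\<in>{L..H}. residue_summand r F m n l)"
      by (subst sum.union_disjoint[symmetric]) (auto simp: L_def H_def intro!: sum.cong)
    finally have AB: "(A - B) m n = - (\<Sum>l\<in>{L..H}. residue_summand r F m n l)" .
    have "delta_sum Z m n = (\<Sum>j<Suc r. (of_int (- m - 1) gchoose j) *s Z (- int j - 1) (n + m + 1 + int j))"
      using Z0 Suc by (intro delta_sum_eq_sum) simp
    also have "\<dots> = (\<Sum>j\<le>r. \<Sum>l\<in>{L..H}. ((of_int (- m - 1) gchoose j) * (of_int l gchoose (r - j))) *s
        F l (n + m + 1 + int r - l))"
    proof (rule sum.cong)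
      fix j assume "j \<in> {..r}"
      then have j: "j \<le> r" by simp
      have ij: "- int j - 1 + int k = int (r - j)" using j Suc by simp
      have "Z (- int j - 1) (n + m + 1 + int j) = (\<Sum>l\<in>{L..H}. (of_int l gchoose nat (int (r - j))) *s
          F l (n + m + 1 + int j - (l - int (r - j))))"
        unfolding Z ij using j by (intro expand_at_diagonal_eq_sum[where N = N] N) (auto simp: L_def H_def)
      also have "\<dots> = (\<Sum>l\<in>{L..H}. (of_int l gchoose (r - j)) *s F l (n + m + 1 + int r - l))"
      proof (rule sum.cong)
        fix l
        have "n + m + 1 + int j - (l - int (r - j)) = n + m + 1 + int r - l" using j by simp
        then show "(of_int l gchoose nat (int (r - j))) *s F l (n + m + 1 + int j - (l - int (r - j))) =
            (of_int l gchoose (r - j)) *s F l (n + m + 1 + int r - l)"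
          by (simp only: nat_int)
      qed simp
      finally show "(of_int (- m - 1) gchoose j) *s Z (- int j - 1) (n + m + 1 + int j) =
          (\<Sum>l\<in>{L..H}. ((of_int (- m - 1) gchoose j) * (of_int l gchoose (r - j))) *s F l (n + m + 1 + int r - l))"
        by (simp add: scale_sum_right)
    qed auto
    also have "\<dots> = (\<Sum>l\<in>{L..H}. (\<Sum>j\<le>r. (of_int (- m - 1) gchoose j) * (of_int l gchoose (r - j))) *s
        F l (n + m + 1 + int r - l))"
      unfolding scale_sum_left by (rule sum.swap)
    also have "\<dots> = (\<Sum>l\<in>{L..H}. residue_summand r F m n l)"
    proof (rule sum.cong)
      fix l
      have "(\<Sum>j\<le>r. (of_int (- m - 1) gchoose j) * (of_int l gchoose (r - j)) :: complex) =
          (of_int (- m - 1) + of_int l) gchoose r"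
        using gbinomial_Vandermonde[of "of_int (- m - 1)" "of_int l" r] by (simp only: atLeast0AtMost)
      also have "of_int (- m - 1) + of_int l = (of_int (l - m - 1) :: complex)" by simp
      finally show "(\<Sum>j\<le>r. (of_int (- m - 1) gchoose j) * (of_int l gchoose (r - j))) *s
          F l (n + m + 1 + int r - l) = residue_summand r F m n l"
        by (simp only: residue_summand_def)
    qed simp
    finally show ?thesis using AB by simp
  qed
qed

end

section \<open>The contribution of the diagonal\<close>

abbreviation linear_factors :: "complex poly list \<Rightarrow> complex poly poly" where
  "linear_factors hs \<equiv> (\<Prod>h\<leftarrow>hs. [:- h, 1:])"

abbreviation remove_factor :: "complex poly \<Rightarrow> complex poly list \<Rightarrow> complex poly list" where
  "remove_factor h hs \<equiv> filter (\<lambda>h'. h' \<noteq> h) hs"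

lemma linear_factors_remove:
  "linear_factors hs = [:- h, 1:] ^ count_list hs h * linear_factors (remove_factor h hs)"
proof (induction hs)
  case (Cons h' hs)
  show ?case
  proof (cases "h' = h")
    case True
    then show ?thesis by (simp only: Cons.IH list.map prod_list.Cons count_list.simps filter.simps
        if_True simp_thms if_False power_add power_one_right mult_ac)
  next
    case False
    then show ?thesis by (simp only: Cons.IH list.map prod_list.Cons count_list.simps filter.simps
        if_True simp_thms if_False mult_ac)
  qed
qed simp

lemma poly2_shift_mult: "poly2_shift (p * q) = poly2_shift p * poly2_shift q"
  by (simp add: poly2_shift_def pcompose_mult)

lemma poly2_shift_power: "poly2_shift (p ^ k) = poly2_shift p ^ k"
proof (induction k)
  case 0
  then show ?case by (simp add: poly2_shift_def pcompose_1)
qed (simp only: power_Suc poly2_shift_mult)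

lemma poly2_shift_diagonal: "poly2_shift [:- [:0, 1:], 1:] = [:0, 1:]"
  by (simp add: poly2_shift_def pcompose_pCons)

lemma poly2_shift_eq_0: "poly2_shift p = 0 \<longleftrightarrow> p = 0"
proof
  assume "poly2_shift p = 0"
  then have "pcompose (poly2_shift p) [:- [:0, 1:], 1:] = 0" by simp
  moreover have "pcompose [:[:0, 1:], 1:] [:- [:0, 1:], 1:] = [:0, 1 :: complex poly:]"
    by (simp add: pcompose_pCons)
  ultimately show "p = 0"
    by (simp only: poly2_shift_def pcompose_assoc[symmetric] pcompose_idR)
qed (simp add: poly2_shift_def)

lemma coeff_0_poly2_shift: "coeff (poly2_shift p) 0 = poly p [:0, 1:]"
  by (simp add: poly2_shift_def poly_0_coeff_0[symmetric] poly_pcompose)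

lemma poly_linear_factors_neq_0:
  assumes "x \<notin> set hs" shows "poly (linear_factors hs) x \<noteq> 0"
  using assms by (induction hs) auto

context complex_vector_space
begin

lemma act_x0_power: "act ([:0, 1:] ^ k) X m n = X (m - int k) n"
proof (induction k arbitrary: m)
  case (Suc k)
  have "act ([:0, 1:] ^ Suc k) X m n = shift1 (act ([:0, 1:] ^ k) X) m n"
    by (simp only: power_Suc act_mult shift1_eq_act)
  then show ?case using Suc[of "m - 1"] by (simp add: shift1_def algebra_simps)
qed (simp add: act_1)

lemma expand_at_diagonal_laurent:
  assumes F: "F \<in> jointly_bounded"
  shows "expand_at_diagonal F \<in> laurent_x0"
proof
  show "expand_at_diagonal F \<in> x1_bounded_below"
    unfolding x1_bounded_below_def expand_at_diagonal_def by auto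
  obtain N where N: "\<And>m n. N < m \<or> N < n \<Longrightarrow> F m n = 0"
    using jointly_boundedE[OF F] by metis
  show "expand_at_diagonal F \<in> x2_bounded"
    unfolding x2_bounded_def
  proof (intro CollectI allI exI impI)
    fix i k assume k: "2 * N - i < k"
    have "F m (k - (m - i)) = 0" for m
      by (rule N) (use k in linarith)
    then show "expand_at_diagonal F i k = 0"
      by (simp add: expand_at_diagonal_def)
  qed
qed

text \<open>Here \<open>A\<close> and \<open>B\<close> stand for the two orders of the product of two fields and \<open>Z\<close> for the
  field of their products in the vertex algebra. Multiplying by the locality factors \<open>q\<close> makes
  \<open>A\<close> and \<open>B\<close> equal to a jointly bounded \<open>F\<close>. As the polynomial \<open>p\<close> can be cancelled,
  associativity holds for \<open>q\<close>; the part of \<open>q\<close> away from the diagonal is invertible near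
  the diagonal, which bounds the pole of \<open>Z\<close>, and the rest is \<open>difference_of_expansions\<close>.\<close>
lemma commutator_of_associativity:
  assumes A: "A \<in> uniformly_x2_bounded" and B: "B \<in> uniformly_x1_bounded"
    and Z: "Z \<in> laurent_x0" and p: "p \<noteq> 0" and pA: "act p A \<in> jointly_bounded"
    and assoc: "expand_at_diagonal (act p A) = act (poly2_shift p) Z"
    and local: "act (linear_factors hs) (A - B) = 0"
  shows "i < - int (count_list hs [:0, 1:]) \<Longrightarrow> Z i n = 0"
    and "act (linear_factors (remove_factor [:0, 1:] hs)) (A - B + delta_sum Z) = 0"
proof -
  define k where "k = count_list hs [:0, 1:]"
  define q where "q = linear_factors hs"
  define q' where "q' = linear_factors (remove_factor [:0, 1:] hs)"
  define F where "F = act q A"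
  have q: "q = [:- [:0, 1:], 1:] ^ k * q'"
    unfolding q_def k_def q'_def by (rule linear_factors_remove)
  have "act q A - act q B = 0"
    using local series.scale_right_diff_distrib[of q A B] by (simp only: q_def)
  then have FB: "act q B = F"
    by (simp only: F_def right_minus_eq)
  have F: "F \<in> jointly_bounded"
  proof
    show "F \<in> uniformly_x2_bounded"
      unfolding F_def by (rule series_space_act[OF series_space_uniformly_x2_bounded A])
    show "F \<in> uniformly_x1_bounded"
      unfolding FB[symmetric] by (rule series_space_act[OF series_space_uniformly_x1_bounded B])
  qed
  \<comment> \<open>Replace \<open>p\<close> by \<open>q\<close> in the associativity relation.\<close>
  have "act (poly2_shift p) (expand_at_diagonal F) = expand_at_diagonal (act p F)"
    by (rule expand_at_diagonal_act[OF F, symmetric])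
  also have "act p F = act q (act p A)"
    by (simp only: F_def act_mult[symmetric] mult.commute)
  also have "expand_at_diagonal (act q (act p A)) = act (poly2_shift q) (act (poly2_shift p) Z)"
    by (simp only: expand_at_diagonal_act[OF pA] assoc)
  also have "\<dots> = act (poly2_shift p) (act (poly2_shift q) Z)"
    by (simp only: act_mult[symmetric] mult.commute)
  finally have "act (poly2_shift p) (expand_at_diagonal F - act (poly2_shift q) Z) = 0"
    by (intro trans[OF series.scale_right_diff_distrib]) (simp only: diff_self)
  moreover have "expand_at_diagonal F - act (poly2_shift q) Z \<in> laurent_x0"
    by (rule series_space_diff[OF series_space_laurent_x0 expand_at_diagonal_laurent[OF F]
          series_space_act[OF series_space_laurent_x0 Z]])
  ultimately have "expand_at_diagonal F - act (poly2_shift q) Z = 0"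
    using act_eq_0_cancel[of "poly2_shift p"] p poly2_shift_eq_0 by blast
  then have expand: "expand_at_diagonal F = act ([:0, 1:] ^ k) (act (poly2_shift q') Z)"
    by (simp only: right_minus_eq q poly2_shift_mult poly2_shift_power poly2_shift_diagonal act_mult)
  have Z': "act (poly2_shift q') Z i n = expand_at_diagonal F (i + int k) n" for i n
    unfolding expand act_x0_power by simp
  have "coeff (poly2_shift q') 0 \<noteq> 0"
    unfolding coeff_0_poly2_shift q'_def by (rule poly_linear_factors_neq_0) simp
  then show "Z i n = 0" if "i < - int (count_list hs [:0, 1:])"
  proof (rule lower_rows_eq_0[of "poly2_shift q'" Z "- int k", OF _ Z])
    show "i < - int k" using that by (simp only: k_def)
    show "act (poly2_shift q') Z m n = 0" if "m < - int k" for m n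
      using that by (simp add: Z' expand_at_diagonal_def)
  qed
  have "act q' A - act q' B = - delta_sum (act (poly2_shift q') Z)"
  proof (rule difference_of_expansions[OF F])
    show "act q' A \<in> uniformly_x2_bounded"
      by (rule series_space_act[OF series_space_uniformly_x2_bounded A])
    show "act q' B \<in> uniformly_x1_bounded"
      by (rule series_space_act[OF series_space_uniformly_x1_bounded B])
    show "act ([:- [:0, 1:], 1:] ^ k) (act q' A) = F"
      by (simp only: F_def q act_mult)
    show "act ([:- [:0, 1:], 1:] ^ k) (act q' B) = F"
      by (simp only: FB[symmetric] q act_mult)
  qed (rule Z')
  also have "delta_sum (act (poly2_shift q') Z) = act q' (delta_sum Z)"
    by (rule delta_sum_act_shift[OF Z])
  finally have "act q' (A - B) = - act q' (delta_sum Z)"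
    by (intro trans[OF series.scale_right_diff_distrib])
  then have "act q' (A - B + delta_sum Z) = 0"
    by (intro trans[OF act_add_right]) (simp only: left_minus)
  then show "act (linear_factors (remove_factor [:0, 1:] hs)) (A - B + delta_sum Z) = 0"
    by (simp only: q'_def)
qed

lemma delta_sum_annihilated:
  assumes Z: "Z \<in> laurent_x0" and Z0: "\<And>i n. i < - int k \<Longrightarrow> Z i n = 0"
  shows "act ([:- [:0, 1:], 1:] ^ k) (delta_sum Z) = 0"
proof -
  have "delta_sum (act ([:0, 1:] ^ k) Z) = 0"
  proof (intro ext)
    fix m n
    show "delta_sum (act ([:0, 1:] ^ k) Z) m n = 0 m n"
      by (subst delta_sum_eq_sum[of 0]) (simp_all add: act_x0_power Z0)
  qed
  then show ?thesis
    using delta_sum_act_shift[OF Z, of "[:- [:0, 1:], 1:] ^ k"]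
    by (simp only: poly2_shift_power poly2_shift_diagonal)
qed

section \<open>Uniqueness of the decomposition into curves\<close>

lemma act_const_eq_0:
  assumes "c \<noteq> 0" "X \<in> x2_bounded" "act [:c:] X = 0"
  shows "X = 0"
proof (intro ext)
  show "X m n = 0 m n" for m n
    using row_eq_0[OF assms(1) _ assms(2), of m] assms(3) by simp
qed

text \<open>On a series killed by \<open>x\<^sub>1 - h(x\<^sub>2)\<close> a factor \<open>x\<^sub>1 - h'(x\<^sub>2)\<close> acts as the nonzero
  polynomial \<open>h(x\<^sub>2) - h'(x\<^sub>2)\<close>, which can be cancelled.\<close>
lemma coprime_annihilators:
  assumes "h \<notin> set hs" "X \<in> x2_bounded" "act [:- h, 1:] X = 0" "act (linear_factors hs) X = 0"
  shows "X = 0"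
  using assms
proof (induction hs)
  case Nil
  then show ?case by (simp only: list.map prod_list.Nil act_1)
next
  case (Cons h' hs)
  define X' where "X' = act (linear_factors hs) X"
  have X': "X' \<in> x2_bounded"
    unfolding X'_def by (rule series_space_act[OF series_space_x2_bounded Cons.prems(2)])
  have "act [:- h, 1:] X' = act (linear_factors hs) (act [:- h, 1:] X)"
    by (simp only: X'_def act_mult[symmetric] mult.commute)
  then have h: "act [:- h, 1:] X' = 0"
    by (simp only: Cons.prems(3) series.scale_zero_right)
  have h': "act [:- h', 1:] X' = 0"
    using Cons.prems(4) by (simp only: X'_def act_mult list.map prod_list.Cons)
  have "[:h - h':] = [:- h', 1:] - [:- h, 1:]" by simp
  then have "act [:h - h':] X' = act [:- h', 1:] X' - act [:- h, 1:] X'"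
    using series.scale_left_diff_distrib[of "[:- h', 1:]" "[:- h, 1:]" X'] by (simp only:)
  then have "act [:h - h':] X' = 0"
    by (simp only: h h' diff_self)
  moreover have "h - h' \<noteq> 0" using Cons.prems(1) by auto
  ultimately have "X' = 0"
    by (intro act_const_eq_0[OF _ X'])
  then show ?case
    using Cons.IH Cons.prems(1-3) unfolding X'_def by simp
qed

text \<open>Away from each curve something else already kills \<open>X\<close>. Removing the factors of the global
  annihilator one at a time, the series obtained before the last factor is killed by coprime
  polynomials.\<close>
lemma vanishes_if_locally:
  assumes X: "X \<in> x2_bounded"
    and local: "\<And>h. h \<in> set hs \<Longrightarrow> act (linear_factors (remove_factor h hs)) X = 0"
    and global: "act (linear_factors hs) X = 0"
  shows "X = 0"
proof -
  have "set gs \<subseteq> set hs \<Longrightarrow> act (linear_factors gs) X = 0 \<Longrightarrow> X = 0" for gs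
  proof (induction gs)
    case Nil
    then show ?case by (simp only: list.map prod_list.Nil act_1)
  next
    case (Cons h gs)
    let ?X = "act (linear_factors gs) X"
    have "?X = 0"
    proof (rule coprime_annihilators[of h "remove_factor h hs"])
      show "?X \<in> x2_bounded"
        by (rule series_space_act[OF series_space_x2_bounded X])
      show "act [:- h, 1:] ?X = 0"
        using Cons.prems(2) by (simp only: act_mult list.map prod_list.Cons)
      have "h \<in> set hs" using Cons.prems(1) by simp
      have "act (linear_factors (remove_factor h hs)) ?X =
          act (linear_factors gs) (act (linear_factors (remove_factor h hs)) X)"
        by (simp only: act_mult[symmetric] mult.commute)
      then show "act (linear_factors (remove_factor h hs)) ?X = 0"
        by (simp only: local[OF \<open>h \<in> set hs\<close>] series.scale_zero_right)
    qed simp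
    then show ?case using Cons.IH Cons.prems(1) by simp
  qed
  then show ?thesis using global by blast
qed

section \<open>Affine change of the curve\<close>

lemma affine_compose_0 [simp]: "affine_compose g 0 = 0"
  by (intro ext) (simp add: affine_compose_def)

text \<open>\<open>g(x\<^sub>1) - h(x\<^sub>2)\<close> is a scalar multiple of \<open>x\<^sub>1 - g'(h(x\<^sub>2))\<close>, where \<open>g'\<close> is the
  inverse of \<open>g\<close>.\<close>
lemma affine_compose_annihilated:
  assumes g: "degree g = 1" and g': "degree g' = 1" and inv: "pcompose g g' = [:0, 1:]"
    and X: "X \<in> x1_bounded" and act: "act (linear_factors hs) X = 0"
  shows "act (linear_factors (map (pcompose g') hs)) (affine_compose g X) = 0"
proof -
  obtain a b where ab: "g = [:b, a:]" "a \<noteq> 0" using g by (metis degree1_coeffs)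
  obtain a' b' where ab': "g' = [:b', a':]" "a' \<noteq> 0" using g' by (metis degree1_coeffs)
  have 1: "a * a' = 1" "b + a * b' = 0"
    using inv by (simp_all add: ab ab' pcompose_pCons)
  have one: "pcompose [:- h, 1:] [:[:b:], [:a:]:] = [:[:a:]:] * [:- pcompose g' h, 1:]" for h
  proof -
    have "smult a (pcompose g' h) = h - [:b:]"
    proof -
      have "smult a (pcompose g' h) = [:a * b':] + smult (a * a') h"
        by (simp add: ab' pcompose_pCons smult_add_right)
      moreover have "a * b' = - b" using 1(2) by (simp only: add_eq_0_iff)
      ultimately show ?thesis by (simp add: 1(1))
    qed
    then show ?thesis by (simp add: pcompose_pCons)
  qed
  have factors: "pcompose (linear_factors hs) [:[:b:], [:a:]:] =
      [:[:a ^ length hs:]:] * linear_factors (map (pcompose g') hs)"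
  proof (induction hs)
    case (Cons h hs)
    have "[:[:a ^ length (h # hs):]:] = [:[:a:]:] * [:[:a ^ length hs:]:]" by simp
    then show ?case
      by (simp only: list.map prod_list.Cons pcompose_mult one Cons.IH mult_ac)
  qed (simp add: pcompose_1 one_pCons)
  have "affine_compose g (act (linear_factors hs) X) =
      act [:[:a ^ length hs:]:] (act (linear_factors (map (pcompose g') hs)) (affine_compose g X))"
    using affine_compose_act[OF g X, of "linear_factors hs"] factors
    by (simp add: ab act_mult)
  then have "scale_series (a ^ length hs) (act (linear_factors (map (pcompose g') hs)) (affine_compose g X)) = 0"
    by (simp only: act affine_compose_0 scale_series_eq_act)
  then show ?thesis using ab(2) by (simp add: fun_eq_iff scale_series_def)
qed

end

text \<open>In terms of generating series,
  \<open>\<delta>(x\<^sub>2/g(x\<^sub>1)) / g(x\<^sub>1) = \<alpha>\<^bsup>-1\<^esup> x\<^sub>1\<^bsup>-1\<^esup> \<delta>(g'(x\<^sub>2)/x\<^sub>1)\<close> for \<open>g\<close> of slope \<open>\<alpha>\<close>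
  and inverse \<open>g'\<close>: the source of the factor \<open>\<phi>(\<sigma>)\<^bsup>-1\<^esup>\<close>.\<close>
lemma affine_power_inverse:
  assumes g: "degree g = 1" and g': "degree g' = 1" and inv: "pcompose g g' = [:0, 1:]"
  shows "affine_power g (- k - 1) m = inverse (coeff g 1) * affine_power g' (- m - 1) k"
proof -
  obtain a b where ab: "g = [:b, a:]" "a \<noteq> 0" using g by (metis degree1_coeffs)
  obtain a' b' where ab': "g' = [:b', a':]" "a' \<noteq> 0" using g' by (metis degree1_coeffs)
  have 1: "a * a' = 1" "b + a * b' = 0"
    using inv by (simp_all add: ab ab' pcompose_pCons)
  have a': "a' = inverse a" using 1(1) by (simp add: inverse_unique)
  have b': "b' = - b * inverse a"
    using 1(2) ab(2) by (simp add: field_simps add_eq_0_iff2)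
  show ?thesis
  proof (cases "m \<le> - k - 1")
    case True
    define i where "i = nat (- k - 1 - m)"
    have i: "nat (- m - 1 - k) = i" "k = - m - 1 - int i" using True by (auto simp: i_def)
    have binom: "(of_int (- k - 1) gchoose i :: complex) = (- 1) ^ i * (of_int (- m - 1) gchoose i)"
    proof -
      have "of_int (- k - 1) = of_nat i - of_int (- m - 1) - (1 :: complex)"
        using i(2) by simp
      then show ?thesis
        using gbinomial_negated_upper[of "of_int (- m - 1) :: complex" i] by simp
    qed
    have pow: "inverse a * (inverse a powi k * inverse a ^ i) = a powi m"
    proof -
      have "inverse a * (inverse a powi k * inverse a ^ i) =
          inverse a powi 1 * (inverse a powi k * inverse a powi int i)" by simp
      also have "\<dots> = inverse a powi (1 + (k + int i))"
        using ab(2) by (simp add: power_int_add)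
      also have "1 + (k + int i) = - m" using i(2) by simp
      finally show ?thesis by (simp add: power_int_minus power_int_inverse)
    qed
    have "(- b * inverse a) ^ i = (- 1) ^ i * b ^ i * inverse a ^ i"
      by (simp only: power_mult_distrib power_minus[of b])
    then have "inverse a * ((of_int (- m - 1) gchoose i) * inverse a powi k * (- b * inverse a) ^ i) =
        ((- 1) ^ i * (of_int (- m - 1) gchoose i)) * (inverse a * (inverse a powi k * inverse a ^ i)) * b ^ i"
      by (simp only: mult_ac)
    also have "\<dots> = (of_int (- k - 1) gchoose i) * a powi m * b ^ i"
      by (simp only: pow binom)
    finally show ?thesis
      using True i(1) by (simp add: affine_power_def ab ab' a' b' i_def[symmetric])
  qed (simp add: affine_power_def)
qed

text \<open>The divided derivative has binomial coefficients: \<open>(k choose j) x\<^bsup>k-j\<^esup>\<close> from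
  \<open>x\<^sup>k\<close>.\<close>
lemma deriv_x2_funpow:
  "(deriv_x2 ^^ j) f m l / fact j = (of_int (l + int j) gchoose j) * f m (l + int j)"
proof (induction j arbitrary: l)
  case (Suc j)
  let ?a = "of_int (l + 1 + int j) :: complex"
  have "of_nat (Suc j) * (?a gchoose Suc j) = (?a - of_nat j) * (?a gchoose j)"
    by (simp only: gbinomial_absorption gbinomial_absorb_comp)
  then have *: "(of_int (l + 1) * (?a gchoose j) :: complex) = of_nat (Suc j) * (?a gchoose Suc j)"
    by simp
  have "(deriv_x2 ^^ Suc j) f m l / fact (Suc j) =
      of_int (l + 1) * ((deriv_x2 ^^ j) f m (l + 1) / fact j) / of_nat (Suc j)"
    by (simp add: deriv_x2_def field_simps)
  also have "\<dots> = (of_int (l + 1) * (?a gchoose j)) * f m (l + 1 + int j) / of_nat (Suc j)"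
    unfolding Suc.IH by (simp only: mult.assoc)
  also have "\<dots> = (?a gchoose Suc j) * f m (l + 1 + int j)"
    unfolding * by (simp del: of_nat_Suc)
  finally show ?case by (simp add: algebra_simps)
qed simp

lemma count_list_map_eq:
  assumes "\<And>h. f h = y \<longleftrightarrow> h = x"
  shows "count_list (map f hs) y = count_list hs x"
  using assms by (induction hs) auto

lemma filter_map_neq:
  assumes "\<And>h. f h = y \<longleftrightarrow> h = x"
  shows "filter (\<lambda>h. h \<noteq> y) (map f hs) = map f (filter (\<lambda>h. h \<noteq> x) hs)"
  using assms by (induction hs) auto

lemma count_list_filter_neq: "h \<noteq> x \<Longrightarrow> count_list (filter (\<lambda>h'. h' \<noteq> h) hs) x = count_list hs x"
  by (induction hs) auto

context complex_vector_space
begin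

lemma scale_Sum_any: "c \<noteq> 0 \<Longrightarrow> c *s Sum_any f = Sum_any (\<lambda>a. c *s f a)"
  by (simp add: Sum_any.expand_set scale_sum_right)

text \<open>The series \<open>c(x\<^sub>2) (1/j!) (\<partial>/\<partial>x\<^sub>2)\<^sup>j x\<^sub>1\<^bsup>-1\<^esup> \<delta>(x\<^sub>2/x\<^sub>1)\<close>, a single summand
  of \<open>delta_sum\<close>.\<close>
definition delta_term :: "nat \<Rightarrow> (int \<Rightarrow> 'w) \<Rightarrow> 'w series2" where
  "delta_term j c = (\<lambda>m n. (of_int (- m - 1) gchoose j) *s c (n + m + 1 + int j))"

lemma affine_compose_delta_term:
  assumes g: "degree g = 1" and g': "degree g' = 1" and inv: "pcompose g g' = [:0, 1:]"
  shows "affine_compose g (delta_term j c) m n = inverse (coeff g 1) *s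
     Sum_any (\<lambda>l. ((deriv_x2 ^^ j) (affine_delta g') m l / fact j) *s c (n - l))"
proof -
  have "coeff g 1 \<noteq> 0"
    using g leading_coeff_neq_0[of g] by (metis degree_0 zero_neq_one)
  then have a: "inverse (coeff g 1) \<noteq> 0" by simp
  have bij: "bij (\<lambda>l::int. - l - 1 - int j)"
    by (rule o_bij[of "\<lambda>l. - l - 1 - int j"]) (auto simp: fun_eq_iff)
  have "affine_compose g (delta_term j c) m n =
      Sum_any (\<lambda>l. affine_power g l m *s delta_term j c l n)"
    by (simp only: affine_compose_def)
  also have "\<dots> = Sum_any (\<lambda>l. inverse (coeff g 1) *s
      (((deriv_x2 ^^ j) (affine_delta g') m l / fact j) *s c (n - l)))"
  proof (rule Sum_any.reindex_cong[OF bij], intro ext)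
    fix l
    have e: "- l - 1 - int j = - (l + int j) - 1" "- (- (l + int j) - 1) - 1 = l + int j"
      "n + (- (l + int j) - 1) + 1 + int j = n - l" by auto
    have "affine_power g (- (l + int j) - 1) m *s ((of_int (l + int j) gchoose j) *s c (n - l)) =
        inverse (coeff g 1) *s (((of_int (l + int j) gchoose j) * affine_delta g' m (l + int j)) *s c (n - l))"
      by (simp only: affine_power_inverse[OF g g' inv] affine_delta_def scale_scale mult_ac)
    then show "((\<lambda>l. affine_power g l m *s delta_term j c l n) \<circ> (\<lambda>l. - l - 1 - int j)) l =
        inverse (coeff g 1) *s (((deriv_x2 ^^ j) (affine_delta g') m l / fact j) *s c (n - l))"
      by (simp only: o_def delta_term_def e deriv_x2_funpow)
  qed
  also have "\<dots> = inverse (coeff g 1) *s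
      Sum_any (\<lambda>l. ((deriv_x2 ^^ j) (affine_delta g') m l / fact j) *s c (n - l))"
    by (rule scale_Sum_any[OF a, symmetric])
  finally show ?thesis .
qed

lemma rows_bounded:
  assumes Z: "Z \<in> laurent_x0"
  obtains N where "\<And>j n. j < k \<Longrightarrow> N < n \<Longrightarrow> Z (- int j - 1) n = 0"
proof -
  have "\<forall>i. \<exists>N. \<forall>n>N. Z i n = 0"
    using Z unfolding x2_bounded_def by blast
  then obtain b where b: "\<And>i n. b i < n \<Longrightarrow> Z i n = 0" by metis
  let ?N = "Max (insert 0 ((\<lambda>j. b (- int j - 1)) ` {..<k}))"
  show ?thesis
  proof (rule that[of ?N])
    fix j n assume "j < k" "?N < n"
    moreover have "b (- int j - 1) \<le> ?N" using \<open>j < k\<close> by (intro Max_ge) auto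
    ultimately show "Z (- int j - 1) n = 0" by (intro b) linarith
  qed
qed

text \<open>A bound on the total degree survives affine substitution and implies the boundedness in
  either variable, which is how the delta series enter the uniqueness argument.\<close>
lemma delta_sum_degree_bounded:
  assumes Z: "Z \<in> laurent_x0"
  obtains N where "\<And>m n. N < m + n \<Longrightarrow> delta_sum Z m n = 0"
proof -
  obtain k where k: "\<And>i n. i < - int k \<Longrightarrow> Z i n = 0"
    using x1_bounded_belowE[OF Z] by metis
  obtain N where N: "\<And>j n. j < k \<Longrightarrow> N < n \<Longrightarrow> Z (- int j - 1) n = 0"
    using rows_bounded[OF Z] by metis
  have "delta_sum Z m n = 0" if "N < m + n" for m n
  proof -
    have "delta_sum Z m n =
        (\<Sum>j<k. (of_int (- m - 1) gchoose j) *s Z (- int j - 1) (n + m + 1 + int j))"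
      by (rule delta_sum_eq_sum[of k Z, OF k])
    also have "\<dots> = 0" using that by (intro sum.neutral ballI) (simp add: N)
    finally show ?thesis .
  qed
  then show ?thesis by (rule that)
qed

lemma delta_sum_x1_bounded: "Z \<in> laurent_x0 \<Longrightarrow> delta_sum Z \<in> x1_bounded"
proof -
  assume "Z \<in> laurent_x0"
  then obtain N where N: "\<And>m n. N < m + n \<Longrightarrow> delta_sum Z m n = 0"
    using delta_sum_degree_bounded by metis
  show ?thesis unfolding x1_bounded_def
  proof (intro CollectI allI exI impI)
    show "delta_sum Z m n = 0" if "N - n < m" for m n using that by (intro N) linarith
  qed
qed

lemma affine_compose_delta_sum_x2_bounded:
  assumes "Z \<in> laurent_x0" shows "affine_compose g (delta_sum Z) \<in> x2_bounded"
proof -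
  obtain N where N: "\<And>m n. N < m + n \<Longrightarrow> delta_sum Z m n = 0"
    using delta_sum_degree_bounded[OF assms] by metis
  show ?thesis unfolding x2_bounded_def
  proof (intro CollectI allI exI impI)
    fix m n assume n: "N - m < n"
    have "affine_power g l m *s delta_sum Z l n = 0" for l
    proof (cases "m \<le> l")
      case True
      then have "delta_sum Z l n = 0" using n by (intro N) linarith
      then show ?thesis by simp
    qed (simp add: affine_power_def)
    then show "affine_compose g (delta_sum Z) m n = 0"
      by (simp only: affine_compose_def Sum_any.expand_set) simp
  qed
qed

lemma affine_compose_delta_sum:
  assumes Z: "Z \<in> laurent_x0" and Z0: "\<And>i n. i < - int k \<Longrightarrow> Z i n = 0"
  shows "affine_compose g (delta_sum Z) m n =
     (\<Sum>j<k. affine_compose g (delta_term j (Z (- int j - 1))) m n)"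
proof -
  obtain N where N: "\<And>j n. j < k \<Longrightarrow> N < n \<Longrightarrow> Z (- int j - 1) n = 0"
    using rows_bounded[OF Z] by metis
  have sum: "delta_sum Z l n = (\<Sum>j<k. delta_term j (Z (- int j - 1)) l n)" for l
    unfolding delta_term_def by (rule delta_sum_eq_sum[of k Z, OF Z0])
  have zero: "delta_term j (Z (- int j - 1)) l n = 0" if "j < k" "N - n < l" for j l
    using that by (simp add: delta_term_def N)
  have "affine_compose g (delta_sum Z) m n = (\<Sum>l\<in>{m..N - n}. affine_power g l m *s delta_sum Z l n)"
    by (intro affine_compose_eq_sum) (simp_all add: sum zero)
  also have "\<dots> = (\<Sum>j<k. \<Sum>l\<in>{m..N - n}. affine_power g l m *s delta_term j (Z (- int j - 1)) l n)"
    unfolding sum scale_sum_right by (rule sum.swap)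
  also have "\<dots> = (\<Sum>j<k. affine_compose g (delta_term j (Z (- int j - 1))) m n)"
    by (intro sum.cong refl affine_compose_eq_sum[symmetric]) (simp_all add: zero)
  finally show ?thesis .
qed

lemma linear_map_0: "Vector_Spaces.linear s1 s2 f \<Longrightarrow> f 0 = 0"
  by (rule module_hom.zero[OF Vector_Spaces.linear.axioms(3)])

section \<open>Commutators of fields\<close>

definition commutator_series :: "'w field_modes \<Rightarrow> 'w field_modes \<Rightarrow> 'w \<Rightarrow> 'w series2" where
  "commutator_series a b w = (\<lambda>m n. op_commutator a b m n w)"

lemma fieldD:
  assumes "a \<in> fields_at_infinity scale"
  shows "Vector_Spaces.linear scale scale (a n)" "\<exists>N. \<forall>m>N. a (- m - 1) w = 0" "a n 0 = 0"
proof -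
  show lin: "Vector_Spaces.linear scale scale (a n)"
    using assms by (simp add: fields_at_infinity_def)
  show "a n 0 = 0" by (rule linear_map_0[OF lin])
  obtain N where "\<forall>n<N. a n w = 0" using assms unfolding fields_at_infinity_def by blast
  then show "\<exists>N. \<forall>m>N. a (- m - 1) w = 0" by (intro exI[of _ "- N"]) auto
qed

lemma commutator_series_x1_bounded:
  assumes a: "a \<in> fields_at_infinity scale" and b: "b \<in> fields_at_infinity scale"
  shows "commutator_series a b w \<in> x1_bounded"
  unfolding x1_bounded_def
proof (intro CollectI allI)
  fix n
  obtain N N' where "\<forall>m>N. a (- m - 1) (b (- n - 1) w) = 0" "\<forall>m>N'. a (- m - 1) w = 0"
    using fieldD(2)[OF a] by metis
  then show "\<exists>N. \<forall>m>N. commutator_series a b w m n = 0"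
    by (intro exI[of _ "max N N'"]) (auto simp: commutator_series_def op_commutator_def fieldD(3)[OF b])
qed

lemma commutator_series_x2_bounded:
  assumes a: "a \<in> fields_at_infinity scale" and b: "b \<in> fields_at_infinity scale"
  shows "commutator_series a b w \<in> x2_bounded"
  unfolding x2_bounded_def
proof (intro CollectI allI)
  fix m
  obtain N N' where "\<forall>n>N. b (- n - 1) (a (- m - 1) w) = 0" "\<forall>n>N'. b (- n - 1) w = 0"
    using fieldD(2)[OF b] by metis
  then show "\<exists>N. \<forall>n>N. commutator_series a b w m n = 0"
    by (intro exI[of _ "max N N'"]) (auto simp: commutator_series_def op_commutator_def fieldD(3)[OF a])
qed

lemma affine_subst_eq_sum:
  assumes "\<And>l. N < l \<Longrightarrow> a (- l - 1) w = 0"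
  shows "affine_subst scale a g (- m - 1) w = (\<Sum>l\<in>{m..N}. affine_power g l m *s a (- l - 1) w)"
proof -
  have bij: "bij (\<lambda>l::int. - l - 1)"
    by (rule o_bij[of "\<lambda>l. - l - 1"]) (auto simp: fun_eq_iff)
  have "affine_subst scale a g (- m - 1) w = Sum_any (\<lambda>l. affine_power g l m *s a (- l - 1) w)"
    unfolding affine_subst_def by (rule Sum_any.reindex_cong[OF bij]) (auto simp: fun_eq_iff)
  also have "\<dots> = (\<Sum>l\<in>{m..N}. affine_power g l m *s a (- l - 1) w)"
    by (rule Sum_any.expand_superset) (use assms in \<open>force simp: affine_power_def split: if_splits\<close>)+
  finally show ?thesis .
qed

text \<open>Substituting in a field is substituting in the first variable of the commutator.\<close>
lemma commutator_series_affine_subst: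
  assumes a: "a \<in> fields_at_infinity scale" and b: "b \<in> fields_at_infinity scale"
  shows "commutator_series (affine_subst scale a g) b w = affine_compose g (commutator_series a b w)"
proof (intro ext)
  fix m n
  obtain N1 N2 where N12: "\<forall>l>N1. a (- l - 1) (b (- n - 1) w) = 0" "\<forall>l>N2. a (- l - 1) w = 0"
    using fieldD(2)[OF a] by metis
  define N where "N = max N1 N2"
  have N: "a (- l - 1) (b (- n - 1) w) = 0" "a (- l - 1) w = 0" if "N < l" for l
    using N12 that by (auto simp: N_def)
  interpret b: Vector_Spaces.linear scale scale "b (- n - 1)"
    by (rule fieldD(1)[OF b])
  have "commutator_series (affine_subst scale a g) b w m n =
      (\<Sum>l\<in>{m..N}. affine_power g l m *s a (- l - 1) (b (- n - 1) w)) -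
      b (- n - 1) (\<Sum>l\<in>{m..N}. affine_power g l m *s a (- l - 1) w)"
    unfolding commutator_series_def op_commutator_def
    by (simp only: affine_subst_eq_sum[of N a "b (- n - 1) w", OF N(1)] affine_subst_eq_sum[of N a w, OF N(2)])
  also have "\<dots> = (\<Sum>l\<in>{m..N}. affine_power g l m *s commutator_series a b w l n)"
    by (simp add: b.sum b.scale sum_subtractf commutator_series_def op_commutator_def scale_right_diff_distrib)
  also have "\<dots> = affine_compose g (commutator_series a b w) m n"
    by (intro affine_compose_eq_sum[symmetric])
      (simp_all add: commutator_series_def op_commutator_def N b.zero)
  finally show "commutator_series (affine_subst scale a g) b w m n =
      affine_compose g (commutator_series a b w) m n" .
qed

lemma poly2_times_eq_act: "poly2_times scale p F m n w = act p (\<lambda>m n. F m n w) m n"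
  by (simp add: poly2_times_def act_def)

lemma shift_subst_eq: "shift_subst scale F i k w = expand_at_diagonal (\<lambda>m n. F m n w) i k"
  by (simp add: shift_subst_def expand_at_diagonal_def)

end

section \<open>The commutator formula for quasi modules at infinity\<close>

context quasi_module_at_infinity
begin

sublocale S: complex_vector_space sW ..

text \<open>The series \<open>Y\<^sub>W(Y(u, x\<^sub>0) v, x\<^sub>2) w\<close>.\<close>
definition product_modes :: "'v \<Rightarrow> 'v \<Rightarrow> 'w \<Rightarrow> 'w series2" where
  "product_modes u v w = (\<lambda>i n. YW (Y u (- i - 1) v) (- n - 1) w)"

lemma product_modes_laurent: "product_modes u v w \<in> S.laurent_x0"
proof
  obtain N where N: "\<forall>n\<ge>N. Y u n v = 0" using V.Y_truncation by blast
  have "YW 0 n w = 0" for n by (rule S.linear_map_0[OF YW_linear])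
  then show "product_modes u v w \<in> S.x1_bounded_below"
    unfolding S.x1_bounded_below_def product_modes_def using N
    by (intro CollectI exI[of _ "- N"]) auto
  show "product_modes u v w \<in> S.x2_bounded"
    unfolding S.x2_bounded_def product_modes_def using S.fieldD(2)[OF YW_field] by blast
qed

lemma commutator_at_diagonal:
  fixes u v :: 'v and w :: 'w
  assumes "S.act (linear_factors hs) (S.commutator_series (YW u) (YW v) w) = 0"
  shows "i < - int (count_list hs [:0, 1:]) \<Longrightarrow> product_modes u v w i n = 0"
    and "S.act (linear_factors (remove_factor [:0, 1:] hs))
      (S.commutator_series (YW u) (YW v) w + S.delta_sum (product_modes u v w)) = 0"
proof -
  define A where "A = (\<lambda>m n. YW u (- m - 1) (YW v (- n - 1) w))"
  define B where "B = (\<lambda>m n. YW v (- n - 1) (YW u (- m - 1) w))"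
  have AB: "S.commutator_series (YW u) (YW v) w = A - B"
    by (simp add: S.commutator_series_def op_commutator_def A_def B_def fun_eq_iff)
  have A: "A \<in> S.uniformly_x2_bounded"
  proof -
    obtain N where "\<forall>n>N. YW v (- n - 1) w = 0" using S.fieldD(2)[OF YW_field] by blast
    then show ?thesis
      by (auto simp: A_def S.uniformly_x2_bounded_def S.fieldD(3)[OF YW_field] intro!: exI[of _ N])
  qed
  have B: "B \<in> S.uniformly_x1_bounded"
  proof -
    obtain N where "\<forall>n>N. YW u (- n - 1) w = 0" using S.fieldD(2)[OF YW_field] by blast
    then show ?thesis
      by (auto simp: B_def S.uniformly_x1_bounded_def S.fieldD(3)[OF YW_field] intro!: exI[of _ N])
  qed
  obtain p where p: "p \<noteq> 0"
    and bounded: "poly2_times sW p (op_product (YW u) (YW v)) \<in> hom_at_infinity2 sW"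
    and assoc: "shift_subst sW (poly2_times sW p (op_product (YW u) (YW v))) =
      poly2_times sW (poly2_shift p) (\<lambda>k n. YW (Y u (- k - 1) v) (- n - 1))"
    using YW_quasi_associativity[of u v] by blast
  have op_A: "(\<lambda>m n. op_product (YW u) (YW v) m n w) = A"
    by (simp add: op_product_def A_def)
  have pA: "(\<lambda>m n. poly2_times sW p (op_product (YW u) (YW v)) m n w) = S.act p A"
    by (simp add: S.poly2_times_eq_act op_product_def A_def)
  have "\<exists>N. \<forall>m n. N < m \<or> N < n \<longrightarrow> S.act p A m n = 0"
    using bounded unfolding pA[symmetric] hom_at_infinity2_def by blast
  then have bounded': "S.act p A \<in> S.jointly_bounded"
    unfolding S.uniformly_x1_bounded_def S.uniformly_x2_bounded_def by blast
  have assoc': "S.expand_at_diagonal (S.act p A) = S.act (poly2_shift p) (product_modes u v w)"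
  proof (intro ext)
    fix i k
    show "S.expand_at_diagonal (S.act p A) i k = S.act (poly2_shift p) (product_modes u v w) i k"
      using fun_cong[OF fun_cong[OF fun_cong[OF assoc]], of i k w]
      by (simp only: S.shift_subst_eq S.poly2_times_eq_act op_A product_modes_def)
  qed
  note local = assms[unfolded AB]
  show "product_modes u v w i n = 0" if "i < - int (count_list hs [:0, 1:])"
    by (rule S.commutator_of_associativity(1)[OF A B product_modes_laurent p bounded' assoc' local that])
  show "S.act (linear_factors (remove_factor [:0, 1:] hs))
      (S.commutator_series (YW u) (YW v) w + S.delta_sum (product_modes u v w)) = 0"
    unfolding AB
    by (rule S.commutator_of_associativity(2)[OF A B product_modes_laurent p bounded' assoc' local])
qed

end

lemma affine_group_inverse:
  assumes "g \<in> carrier affine_group"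
  shows "degree g = 1" "degree (inv\<^bsub>affine_group\<^esub> g) = 1"
    "pcompose g (inv\<^bsub>affine_group\<^esub> g) = [:0, 1:]" "pcompose (inv\<^bsub>affine_group\<^esub> g) g = [:0, 1:]"
  using assms group.inv_closed[OF group_affine_group assms] group.r_inv[OF group_affine_group assms]
    group.l_inv[OF group_affine_group assms]
  by (simp_all add: affine_group_def)

lemma pcompose_eq_X_iff:
  assumes "g \<in> carrier affine_group"
  shows "pcompose g h = [:0, 1:] \<longleftrightarrow> h = inv\<^bsub>affine_group\<^esub> g"
proof
  assume "pcompose g h = [:0, 1:]"
  then have "pcompose (inv\<^bsub>affine_group\<^esub> g) (pcompose g h) = inv\<^bsub>affine_group\<^esub> g"
    by (simp only: pcompose_idR)
  then show "h = inv\<^bsub>affine_group\<^esub> g"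
    by (simp add: pcompose_assoc affine_group_inverse(4)[OF assms] pcompose_pCons)
qed (simp add: affine_group_inverse(3)[OF assms])

context vertex_group_quasi_module_at_infinity
begin

abbreviation Psi_inv :: "'g \<Rightarrow> complex poly" where
  "Psi_inv \<sigma> \<equiv> inv\<^bsub>affine_group\<^esub> (\<Psi> \<sigma>)"

lemma Psi_carrier: "\<sigma> \<in> carrier \<Gamma> \<Longrightarrow> \<Psi> \<sigma> \<in> carrier affine_group"
  using Psi_hom by (auto simp: hom_def)

lemma Psi_inv_eq: "\<sigma> \<in> carrier \<Gamma> \<Longrightarrow> \<Psi> (inv \<sigma>) = Psi_inv \<sigma>"
proof -
  interpret group_hom \<Gamma> affine_group \<Psi>
    by (intro group_hom.intro group_hom_axioms.intro is_group group_affine_group Psi_hom)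
  show "\<sigma> \<in> carrier \<Gamma> \<Longrightarrow> \<Psi> (inv \<sigma>) = Psi_inv \<sigma>" by (rule hom_inv)
qed

text \<open>Applying \<open>YW_L\<close> to \<open>\<sigma>\<^bsup>-1\<^esup>\<close> undoes the substitution; this avoids a composition law
  for affine substitutions.\<close>
lemma YW_L_inverse:
  assumes \<sigma>: "\<sigma> \<in> carrier \<Gamma>"
  shows "YW u = affine_subst sW (YW (L \<sigma> u)) (\<Psi> \<sigma>)"
proof -
  interpret A: group affine_group by (rule group_affine_group)
  have "L (inv \<sigma> \<otimes> \<sigma>) = L (inv \<sigma>) \<circ> L \<sigma>"
    using hom_mult[OF L_hom inv_closed[OF \<sigma>] \<sigma>] by (simp add: general_linear_group_def)
  moreover have "L \<one> = id"
  proof -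
    have "L \<one> \<circ> L \<one> = L \<one>"
      using hom_mult[OF L_hom one_closed one_closed] by (simp add: general_linear_group_def)
    moreover have "surj (L \<one>)"
      using hom_in_carrier[OF L_hom one_closed] by (simp add: general_linear_group_def bij_def)
    ultimately show ?thesis by (metis comp_apply eq_id_iff surjD)
  qed
  ultimately have "L (inv \<sigma>) (L \<sigma> u) = u"
    using \<sigma> by (simp add: fun_eq_iff)
  then show ?thesis
    using YW_L[OF inv_closed[OF \<sigma>], of "L \<sigma> u"] Psi_inv_eq[OF \<sigma>] A.inv_inv[OF Psi_carrier[OF \<sigma>]] by simp
qed

text \<open>The contribution of \<open>\<sigma>\<close> to the formula, up to sign: the diagonal contribution for
  \<open>L(\<sigma>) u\<close>, moved to the curve \<open>x\<^sub>1 = \<Psi>(\<sigma>)\<^bsup>-1\<^esup>(x\<^sub>2)\<close>.\<close>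
definition delta_part :: "'v \<Rightarrow> 'v \<Rightarrow> 'w \<Rightarrow> 'g \<Rightarrow> 'w series2" where
  "delta_part u v w \<sigma> = S.affine_compose (\<Psi> \<sigma>) (S.delta_sum (product_modes (L \<sigma> u) v w))"

lemma commutator_term_eq:
  assumes \<sigma>: "\<sigma> \<in> carrier \<Gamma>"
  shows "commutator_term Y L \<phi> sW YW \<Psi> u v \<sigma> j m n w =
    S.affine_compose (\<Psi> \<sigma>) (S.delta_term j (product_modes (L \<sigma> u) v w (- int j - 1))) m n"
proof -
  note g = affine_group_inverse[OF Psi_carrier[OF \<sigma>]]
  have "- (- int j - 1) - 1 = int j" by simp
  then show ?thesis
    unfolding S.affine_compose_delta_term[OF g(1,2,3)] commutator_term_def field_x2_times_def
      product_modes_def phi_eq[OF \<sigma>] affine_slope_def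
    by (simp only:)
qed

text \<open>Substituting \<open>\<Psi>(\<sigma>)\<^bsup>-1\<^esup>\<close> moves the factor of the curve of \<open>\<sigma>\<close> to the diagonal factor,
  where \<open>commutator_at_diagonal\<close> applies to \<open>L(\<sigma>) u\<close>; substituting \<open>\<Psi>(\<sigma>)\<close> moves the result
  back.\<close>
lemma commutator_at:
  fixes u v :: 'v and \<sigma> :: 'g
  assumes \<sigma>: "\<sigma> \<in> carrier \<Gamma>"
    and local: "\<And>w. S.act (linear_factors hs) (S.commutator_series (YW u) (YW v) w) = 0"
  defines "k \<equiv> count_list hs (Psi_inv \<sigma>)"
  shows product_modes_eq_0: "\<And>i n w. i < - int k \<Longrightarrow> product_modes (L \<sigma> u) v w i n = 0"
    and commutator_near: "S.act (linear_factors (remove_factor (Psi_inv \<sigma>) hs))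
      (S.commutator_series (YW u) (YW v) w + delta_part u v w \<sigma>) = 0"
    and delta_part_annihilated: "S.act ([:- Psi_inv \<sigma>, 1:] ^ k) (delta_part u v w \<sigma>) = 0"
proof -
  let ?g = "\<Psi> \<sigma>" and ?g' = "Psi_inv \<sigma>"
  let ?hs = "map (pcompose ?g) hs"
  note g = affine_group_inverse[OF Psi_carrier[OF \<sigma>]]
  note X_iff = pcompose_eq_X_iff[OF Psi_carrier[OF \<sigma>]]
  let ?D = "\<lambda>w. S.commutator_series (YW (L \<sigma> u)) (YW v) w"
  have cancel_inv: "map (pcompose ?g') (map (pcompose ?g) gs) = gs" for gs
    by (induction gs) (simp_all add: pcompose_assoc g(4) pcompose_pCons)
  have "?D w = S.affine_compose ?g' (S.commutator_series (YW u) (YW v) w)" for w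
    unfolding YW_L[OF \<sigma>] by (rule S.commutator_series_affine_subst[OF YW_field YW_field])
  then have local': "S.act (linear_factors ?hs) (?D w) = 0" for w
    using S.affine_compose_annihilated[OF g(2,1,4)
        S.commutator_series_x1_bounded[OF YW_field YW_field] local] by (simp only:)
  have count: "count_list ?hs [:0, 1:] = k"
    unfolding k_def by (rule count_list_map_eq[OF X_iff])
  show zero: "product_modes (L \<sigma> u) v w i n = 0" if "i < - int k" for i n w
    using commutator_at_diagonal(1)[OF local'] that unfolding count .
  have remove: "remove_factor [:0, 1:] ?hs = map (pcompose ?g) (remove_factor ?g' hs)"
    by (rule filter_map_neq[OF X_iff])
  let ?Z = "product_modes (L \<sigma> u) v w"
  have 1: "?D w \<in> S.x1_bounded" "S.delta_sum ?Z \<in> S.x1_bounded"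
    by (rule S.commutator_series_x1_bounded[OF YW_field YW_field])
      (rule S.delta_sum_x1_bounded[OF product_modes_laurent])
  have "S.act (linear_factors (map (pcompose ?g') (remove_factor [:0, 1:] ?hs)))
      (S.affine_compose ?g (?D w + S.delta_sum ?Z)) = 0"
    by (rule S.affine_compose_annihilated[OF g(1-3) S.series_spaceD(2)[OF S.series_space_x1_bounded 1]
          commutator_at_diagonal(2)[OF local']])
  moreover have "S.affine_compose ?g (?D w + S.delta_sum ?Z) =
      S.commutator_series (YW u) (YW v) w + delta_part u v w \<sigma>"
  proof -
    have "S.commutator_series (YW u) (YW v) w = S.affine_compose ?g (?D w)"
      by (subst YW_L_inverse[OF \<sigma>]) (rule S.commutator_series_affine_subst[OF YW_field YW_field])
    then show ?thesis
      using S.affine_compose_add[OF 1] by (simp only: delta_part_def)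
  qed
  ultimately show "S.act (linear_factors (remove_factor ?g' hs))
      (S.commutator_series (YW u) (YW v) w + delta_part u v w \<sigma>) = 0"
    by (simp only: remove cancel_inv)
  have "S.act (linear_factors (replicate k [:0, 1:])) (S.delta_sum ?Z) = 0"
    using S.delta_sum_annihilated[OF product_modes_laurent zero]
    by (simp only: map_replicate prod_list_replicate)
  from S.affine_compose_annihilated[OF g(1-3) 1(2) this]
  show "S.act ([:- ?g', 1:] ^ k) (delta_part u v w \<sigma>) = 0"
    by (simp only: delta_part_def map_replicate prod_list_replicate pcompose_idR)
qed

lemma delta_part_eq_sum:
  assumes \<sigma>: "\<sigma> \<in> carrier \<Gamma>"
    and zero: "\<And>i n. i < - int k \<Longrightarrow> product_modes (L \<sigma> u) v w i n = 0"
  shows "delta_part u v w \<sigma> m n = (\<Sum>j<k. commutator_term Y L \<phi> sW YW \<Psi> u v \<sigma> j m n w)"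
  unfolding delta_part_def commutator_term_eq[OF \<sigma>]
  by (rule S.affine_compose_delta_sum[OF product_modes_laurent zero])

lemma commutator_term_eq_0:
  assumes \<sigma>: "\<sigma> \<in> carrier \<Gamma>"
    and local: "\<And>w. S.act (linear_factors hs) (S.commutator_series (YW u) (YW v) w) = 0"
    and j: "count_list hs (Psi_inv \<sigma>) \<le> j"
  shows "commutator_term Y L \<phi> sW YW \<Psi> u v \<sigma> j m n w = 0"
proof -
  have "product_modes (L \<sigma> u) v w (- int j - 1) = (\<lambda>_. 0)"
    using product_modes_eq_0[OF \<sigma> local] j by (intro ext) simp
  moreover have "S.delta_term j (\<lambda>_. 0) = 0"
    by (intro ext) (simp add: S.delta_term_def)
  ultimately show ?thesis
    unfolding commutator_term_eq[OF \<sigma>] by (simp only: S.affine_compose_0 zero_fun_apply)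
qed

text \<open>The contributions are combined by \<open>vanishes_if_locally\<close>: near the curve of \<open>\<tau>\<close>
  the commutator cancels against the contribution of \<open>\<tau>\<close>, and the other contributions are killed
  by the factors of their own curves.\<close>
lemma commutator_formula:
  assumes S: "finite S" "S \<subseteq> carrier \<Gamma>" "inj_on \<Psi> S"
    and hs: "set hs \<subseteq> Psi_inv ` S"
    and local: "\<And>w. S.act (linear_factors hs) (S.commutator_series (YW u) (YW v) w) = 0"
  shows "op_commutator (YW u) (YW v) m n w =
    - (\<Sum>\<sigma>\<in>S. \<Sum>j<count_list hs (Psi_inv \<sigma>). commutator_term Y L \<phi> sW YW \<Psi> u v \<sigma> j m n w)"
proof -
  interpret A: group affine_group by (rule group_affine_group)
  define D where "D = S.commutator_series (YW u) (YW v) w"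
  define R where "R = delta_part u v w"
  have inj: "\<sigma> = \<tau>" if "\<sigma> \<in> S" "\<tau> \<in> S" "Psi_inv \<sigma> = Psi_inv \<tau>" for \<sigma> \<tau>
  proof -
    have "\<Psi> \<sigma> = \<Psi> \<tau>"
      using that S(2) Psi_carrier by (metis A.inv_inv subsetD)
    then show ?thesis using inj_onD[OF S(3)] that by blast
  qed
  have killed: "S.act (linear_factors gs) (R \<sigma>) = 0"
    if "\<sigma> \<in> S" "count_list gs (Psi_inv \<sigma>) = count_list hs (Psi_inv \<sigma>)" for \<sigma> gs
  proof -
    have \<sigma>: "\<sigma> \<in> carrier \<Gamma>" using that S(2) by blast
    let ?rest = "linear_factors (remove_factor (Psi_inv \<sigma>) gs)"
    have "linear_factors gs = ?rest * [:- Psi_inv \<sigma>, 1:] ^ count_list hs (Psi_inv \<sigma>)"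
      using linear_factors_remove[of gs "Psi_inv \<sigma>"] that(2) by (simp only: mult.commute)
    then have "S.act (linear_factors gs) (R \<sigma>) =
        S.act ?rest (S.act ([:- Psi_inv \<sigma>, 1:] ^ count_list hs (Psi_inv \<sigma>)) (R \<sigma>))"
      by (simp only: S.act_mult)
    then show ?thesis
      by (simp only: R_def delta_part_annihilated[OF \<sigma> local] S.series.scale_zero_right)
  qed
  have "D + (\<Sum>\<sigma>\<in>S. R \<sigma>) = 0"
  proof (rule S.vanishes_if_locally)
    have "(\<Sum>\<sigma>\<in>S'. R \<sigma>) \<in> S.x2_bounded" for S'
    proof (induction S' rule: infinite_finite_induct)
      case (insert \<sigma> S')
      have "R \<sigma> \<in> S.x2_bounded"
        unfolding R_def delta_part_def
        by (rule S.affine_compose_delta_sum_x2_bounded[OF product_modes_laurent])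
      then show ?case
        unfolding sum.insert[OF insert(1,2)]
        by (rule S.series_spaceD(2)[OF S.series_space_x2_bounded _ insert(3)])
    qed (simp_all only: sum.infinite sum.empty S.series_spaceD(1)[OF S.series_space_x2_bounded] simp_thms)
    then show "D + (\<Sum>\<sigma>\<in>S. R \<sigma>) \<in> S.x2_bounded"
      unfolding D_def
      by (intro S.series_spaceD(2)[OF S.series_space_x2_bounded]
          S.commutator_series_x2_bounded[OF YW_field YW_field])
  next
    fix h assume "h \<in> set hs"
    then obtain \<tau> where \<tau>: "\<tau> \<in> S" "h = Psi_inv \<tau>" using hs by blast
    let ?q = "linear_factors (remove_factor h hs)"
    have "S.act ?q (D + (\<Sum>\<sigma>\<in>S. R \<sigma>)) = S.act ?q (D + R \<tau>) + (\<Sum>\<sigma>\<in>S - {\<tau>}. S.act ?q (R \<sigma>))"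
      unfolding sum.remove[OF S(1) \<tau>(1)] S.act_add_right S.series.scale_sum_right by (simp only: add.assoc)
    also have "S.act ?q (D + R \<tau>) = 0"
      unfolding D_def R_def \<tau>(2) using \<tau>(1) S(2) by (intro commutator_near local) blast
    also have "(\<Sum>\<sigma>\<in>S - {\<tau>}. S.act ?q (R \<sigma>)) = 0"
    proof (rule sum.neutral, rule ballI)
      fix \<sigma> assume \<sigma>: "\<sigma> \<in> S - {\<tau>}"
      then have "h \<noteq> Psi_inv \<sigma>" using inj[of \<sigma> \<tau>] \<tau> by auto
      then show "S.act ?q (R \<sigma>) = 0"
        using \<sigma> by (intro killed count_list_filter_neq) auto
    qed
    finally show "S.act ?q (D + (\<Sum>\<sigma>\<in>S. R \<sigma>)) = 0" by (simp only: add_0_left)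
  next
    have "(\<Sum>\<sigma>\<in>S. S.act (linear_factors hs) (R \<sigma>)) = 0"
      by (intro sum.neutral ballI killed refl)
    then show "S.act (linear_factors hs) (D + (\<Sum>\<sigma>\<in>S. R \<sigma>)) = 0"
      unfolding S.act_add_right S.series.scale_sum_right by (simp only: D_def local add_0_left)
  qed
  then have "D m n + (\<Sum>\<sigma>\<in>S. R \<sigma>) m n = 0"
    by (metis plus_fun_apply zero_fun_apply)
  moreover have "(\<Sum>\<sigma>\<in>S. R \<sigma>) m n = (\<Sum>\<sigma>\<in>S. R \<sigma> m n)"
    using S(1) by (induction S rule: finite_induct) auto
  moreover have "(\<Sum>\<sigma>\<in>S. R \<sigma> m n) =
      (\<Sum>\<sigma>\<in>S. \<Sum>j<count_list hs (Psi_inv \<sigma>). commutator_term Y L \<phi> sW YW \<Psi> u v \<sigma> j m n w)"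
    unfolding R_def using S(2)
    by (intro sum.cong refl delta_part_eq_sum product_modes_eq_0[OF _ local]) auto
  ultimately show ?thesis
    by (simp add: D_def S.commutator_series_def eq_neg_iff_add_eq_0)
qed

lemma locality_factors:
  obtains hs where "set hs \<subseteq> \<Psi> ` carrier \<Gamma>"
    "\<And>w. S.act (linear_factors hs) (S.commutator_series (YW u) (YW v) w) = 0"
proof -
  obtain hs where hs: "set hs \<subseteq> \<Psi> ` carrier \<Gamma>"
    "poly2_times sW (linear_factors hs) (op_commutator (YW u) (YW v)) = (\<lambda>_ _ _. 0)"
    using YW_local unfolding H_local_def by blast
  show ?thesis
  proof (rule that[OF hs(1)], intro ext)
    fix w m n
    show "S.act (linear_factors hs) (S.commutator_series (YW u) (YW v) w) m n = 0 m n"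
      using fun_cong[OF fun_cong[OF fun_cong[OF hs(2)]], of m n w]
      by (simp only: S.poly2_times_eq_act S.commutator_series_def zero_fun_apply)
  qed
qed

end

theorem theorem2p17:
  fixes sV :: "complex \<Rightarrow> 'v::ab_group_add \<Rightarrow> 'v"
    and Y :: "'v \<Rightarrow> int \<Rightarrow> 'v \<Rightarrow> 'v" and vac :: 'v
    and \<Gamma> :: "('g, 'b) monoid_scheme"
    and L :: "'g \<Rightarrow> 'v \<Rightarrow> 'v" and \<phi> :: "'g \<Rightarrow> complex"
    and sW :: "complex \<Rightarrow> 'w::ab_group_add \<Rightarrow> 'w"
    and YW :: "'v \<Rightarrow> int \<Rightarrow> 'w \<Rightarrow> 'w"
    and \<Psi> :: "'g \<Rightarrow> complex poly"
    and u v :: 'v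
  assumes "vertex_group_quasi_module_at_infinity sV Y vac \<Gamma> L \<phi> sW YW \<Psi>"
  shows "(\<exists>S. finite S \<and> S \<subseteq> carrier \<Gamma> \<and> inj_on \<Psi> S \<and>
            (\<forall>m n w. op_commutator (YW u) (YW v) m n w =
               - (\<Sum>\<sigma>\<in>S. Sum_any (\<lambda>j. commutator_term Y L \<phi> sW YW \<Psi> u v \<sigma> j m n w)))) \<and>
         (inj_on \<Psi> (carrier \<Gamma>) \<longrightarrow>
            (let T = {(\<sigma>, j). \<sigma> \<in> carrier \<Gamma> \<and>
                        commutator_term Y L \<phi> sW YW \<Psi> u v \<sigma> j \<noteq> (\<lambda>_ _ _. 0)}
             in finite T \<and>
                (\<forall>m n w. op_commutator (YW u) (YW v) m n w =
                   - (\<Sum>(\<sigma>, j)\<in>T. commutator_term Y L \<phi> sW YW \<Psi> u v \<sigma> j m n w))))"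
proof -
  interpret vertex_group_quasi_module_at_infinity sV Y vac \<Gamma> L \<phi> sW YW \<Psi> by fact
  interpret A: group affine_group by (rule group_affine_group)
  let ?t = "commutator_term Y L \<phi> sW YW \<Psi> u v"
  obtain hs where hs: "set hs \<subseteq> \<Psi> ` carrier \<Gamma>"
    and local: "\<And>w. S.act (linear_factors hs) (S.commutator_series (YW u) (YW v) w) = 0"
    using locality_factors by blast
  have "\<exists>\<sigma>\<in>carrier \<Gamma>. Psi_inv \<sigma> = h" if h: "h \<in> set hs" for h
  proof -
    obtain \<tau> where \<tau>: "\<tau> \<in> carrier \<Gamma>" "h = \<Psi> \<tau>" using h hs by blast
    have "Psi_inv (inv\<^bsub>\<Gamma>\<^esub> \<tau>) = h"
      using Psi_inv_eq[OF \<tau>(1)] A.inv_inv[OF Psi_carrier[OF \<tau>(1)]] \<tau>(2) by simp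
    then show ?thesis using inv_closed[OF \<tau>(1)] by blast
  qed
  then obtain \<rho> where \<rho>: "\<And>h. h \<in> set hs \<Longrightarrow> \<rho> h \<in> carrier \<Gamma>" "\<And>h. h \<in> set hs \<Longrightarrow> Psi_inv (\<rho> h) = h"
    by metis
  \<comment> \<open>One \<open>\<sigma>\<close> for each curve \<open>x\<^sub>1 = h(x\<^sub>2)\<close> occurring in the locality relation.\<close>
  define S where "S = \<rho> ` set hs"
  have S: "finite S" "S \<subseteq> carrier \<Gamma>" "set hs \<subseteq> Psi_inv ` S"
    using \<rho> by (force simp: S_def)+
  have inj: "inj_on \<Psi> S"
    unfolding S_def by (intro inj_onI) (metis \<rho>(2) imageE)
  have formula: "op_commutator (YW u) (YW v) m n w =
      - (\<Sum>\<sigma>\<in>S. \<Sum>j<count_list hs (Psi_inv \<sigma>). ?t \<sigma> j m n w)" for m n w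
    by (rule commutator_formula[OF S(1,2) inj S(3) local])
  have zero: "?t \<sigma> j m n w = 0" if "\<sigma> \<in> carrier \<Gamma>" "count_list hs (Psi_inv \<sigma>) \<le> j" for \<sigma> j m n w
    by (rule commutator_term_eq_0[OF that(1) local that(2)])
  have any: "Sum_any (\<lambda>j. ?t \<sigma> j m n w) = (\<Sum>j<count_list hs (Psi_inv \<sigma>). ?t \<sigma> j m n w)"
    if "\<sigma> \<in> S" for \<sigma> m n w
  proof (rule Sum_any.expand_superset)
    have "j < count_list hs (Psi_inv \<sigma>)" if "?t \<sigma> j m n w \<noteq> 0" for j
      using zero[of \<sigma> j m n w] that \<open>\<sigma> \<in> S\<close> S(2) by (meson linorder_not_le subsetD)
    then show "{j. ?t \<sigma> j m n w \<noteq> 0} \<subseteq> {..<count_list hs (Psi_inv \<sigma>)}" by blast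
  qed simp
  have part1: "op_commutator (YW u) (YW v) m n w = - (\<Sum>\<sigma>\<in>S. Sum_any (\<lambda>j. ?t \<sigma> j m n w))" for m n w
    unfolding formula using any by (simp cong: sum.cong)
  have part2: "finite T \<and> (\<forall>m n w. op_commutator (YW u) (YW v) m n w = - (\<Sum>(\<sigma>, j)\<in>T. ?t \<sigma> j m n w))"
    if inj': "inj_on \<Psi> (carrier \<Gamma>)"
      and T: "T = {(\<sigma>, j). \<sigma> \<in> carrier \<Gamma> \<and> ?t \<sigma> j \<noteq> (\<lambda>_ _ _. 0)}" for T
  proof -
    \<comment> \<open>Injectivity of \<open>\<Psi>\<close> makes \<open>S\<close> contain every \<open>\<sigma>\<close> with a nonzero term.\<close>
    define P where "P = Sigma S (\<lambda>\<sigma>. {..<count_list hs (Psi_inv \<sigma>)})"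
    have P: "finite P" using S(1) by (simp add: P_def)
    have "T \<subseteq> P"
    proof
      fix x assume "x \<in> T"
      then obtain \<sigma> j where x: "x = (\<sigma>, j)" "\<sigma> \<in> carrier \<Gamma>" "?t \<sigma> j \<noteq> (\<lambda>_ _ _. 0)"
        unfolding T by blast
      have "\<not> count_list hs (Psi_inv \<sigma>) \<le> j"
      proof
        assume "count_list hs (Psi_inv \<sigma>) \<le> j"
        then have "?t \<sigma> j = (\<lambda>_ _ _. 0)" by (intro ext zero x(2))
        then show False using x(3) by blast
      qed
      then have j: "j < count_list hs (Psi_inv \<sigma>)" by simp
      then have "Psi_inv \<sigma> \<in> set hs" by (metis count_notin not_less_zero)
      then obtain \<tau> where \<tau>: "\<tau> \<in> S" "Psi_inv \<sigma> = Psi_inv \<tau>" using S(3) by blast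
      then have "\<Psi> \<sigma> = \<Psi> \<tau>"
        using A.inv_inv Psi_carrier x(2) S(2) by (metis subsetD)
      then have "\<sigma> = \<tau>" using inj_onD[OF inj'] x(2) \<tau>(1) S(2) by blast
      then show "x \<in> P" using j \<tau>(1) x(1) by (simp add: P_def)
    qed
    have "(\<Sum>\<sigma>\<in>S. \<Sum>j<count_list hs (Psi_inv \<sigma>). ?t \<sigma> j m n w) = (\<Sum>(\<sigma>, j)\<in>T. ?t \<sigma> j m n w)" for m n w
    proof -
      have "(\<Sum>\<sigma>\<in>S. \<Sum>j<count_list hs (Psi_inv \<sigma>). ?t \<sigma> j m n w) = (\<Sum>(\<sigma>, j)\<in>P. ?t \<sigma> j m n w)"
        unfolding P_def by (rule sum.Sigma[OF S(1)]) simp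
      also have "\<dots> = (\<Sum>(\<sigma>, j)\<in>T. ?t \<sigma> j m n w)"
      proof (rule sum.mono_neutral_right[OF P \<open>T \<subseteq> P\<close>], rule ballI)
        fix x assume "x \<in> P - T"
        then show "(case x of (\<sigma>, j) \<Rightarrow> ?t \<sigma> j m n w) = 0"
          using S(2) by (cases x) (auto simp: P_def T)
      qed
      finally show ?thesis .
    qed
    then show ?thesis
      using finite_subset[OF \<open>T \<subseteq> P\<close> P] formula by (simp only:) simp
  qed
  show ?thesis
    unfolding Let_def using S(1,2) inj part1 part2[OF _ refl] by blast
qed

end
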